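(* Let $\mathcal{P}(X,U)$ be a system of $n$ linear differential polynomial parametric equations $x_i=P_i(U)=a_i-\sum_{j=1}^{n-1}\mathcal{L}_{ij}(u_j)$, $i=1,\dots,n$, with $a_i\in\mathbb{K}$ and $\mathcal{L}_{ij}\in\mathbb{K}[\partial]$. A necessary condition for $\mathcal{P}(X,U)$ to be proper is $$(\mathcal{L}_{1j},\dots,\mathcal{L}_{nj})=1,\qquad j=1,\dots,n-1,$$ i.e. if $\mathcal{P}(X,U)$ is proper, then for every $j\in\{1,\dots,n-1\}$ the operators $\mathcal{L}_{1j},\dots,\mathcal{L}_{nj}$ are coprime.
   Context: $\mathbb{K}$ is an ordinary differential field with derivation $\partial$, $n\ge 2$, $X=\{x_1,\dots,x_n\}$ and $U=\{u_1,\dots,u_{n-1}\}$ are sets of differential indeterminates over $\mathbb{K}$. $\mathbb{E}$ is a universal differential extension field of $\mathbb{K}$ containing the indeterminates $U$. $\mathbb{K}\{X\}$, $\mathbb{K}\{U\}$ are the rings of differential polynomials and $\mathbb{K}[\partial]$ is the ring of linear differential operators. The $P_i\in\mathbb{K}\{U\}$ have degree at most $1$ and are not all in $\mathbb{K}$. Standing assumption: for each $j$ there is $i$ with $\mathcal{L}_{ij}\ne0$. $\mathbb{K}[\partial]$ is right Euclidean; $\mathcal{L}_j=\gcd_{\text{right}}(\mathcal{L}_{1j},\dots,\mathcal{L}_{nj})$ denotes the greatest common right divisor, so $\mathcal{L}_{ij}=\mathcal{L}'_{ij}\mathcal{L}_j$ for some $\mathcal{L}'_{ij}\in\mathbb{K}[\partial]$.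 The operators $\mathcal{L}_{1j},\dots,\mathcal{L}_{nj}$ are coprime, written $(\mathcal{L}_{1j},\dots,\mathcal{L}_{nj})=1$, if $\mathcal{L}_j\in\mathbb{K}$ (note $\mathcal{L}_j\ne0$). $\mathrm{ID}=\{f\in\mathbb{K}\{X\}: f(P_1(U),\dots,P_n(U))=0\}$ is the implicit ideal. A generic zero of $\mathrm{ID}$ is a point of $\mathbb{E}^n$ such that the differential polynomials in $\mathbb{K}\{X\}$ vanishing at it are exactly the elements of $\mathrm{ID}$; $(P_1(U),\dots,P_n(U))$ is one. The system is proper if for a generic zero $(\Gamma_1,\dots,\Gamma_n)$ of $\mathrm{ID}$ there exists only one $(\tau_1,\dots,\tau_{n-1})\in\mathbb{E}^{n-1}$ with $\Gamma_i=P_i(\tau_1,\dots,\tau_{n-1})$, $i=1,\dots,n$. *)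

theory Defs
  imports
    "HOL-Algebra.Embedded_Algebras"
    "HOL-Algebra.Algebraic_Closure_Type"
    "HOL-Library.Poly_Mapping"
    "HOL-Computational_Algebra.Polynomial"
begin

section \<open>Ordinary differential fields\<close>

definition derivation :: "('a, 'b) ring_scheme \<Rightarrow> ('a \<Rightarrow> 'a) \<Rightarrow> bool" where
  "derivation R d \<longleftrightarrow> d \<in> carrier R \<rightarrow> carrier R \<and>
     (\<forall>x \<in> carrier R. \<forall>y \<in> carrier R.
        d (x \<oplus>\<^bsub>R\<^esub> y) = d x \<oplus>\<^bsub>R\<^esub> d y \<and>
        d (x \<otimes>\<^bsub>R\<^esub> y) = (d x \<otimes>\<^bsub>R\<^esub> y) \<oplus>\<^bsub>R\<^esub> (x \<otimes>\<^bsub>R\<^esub> d y))"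

definition diff_field :: "('a, 'b) ring_scheme \<Rightarrow> ('a \<Rightarrow> 'a) \<Rightarrow> bool" where
  "diff_field R d \<longleftrightarrow> field R \<and> derivation R d"

definition diff_subfield :: "('a, 'b) ring_scheme \<Rightarrow> ('a \<Rightarrow> 'a) \<Rightarrow> 'a set \<Rightarrow> bool" where
  "diff_subfield R d F \<longleftrightarrow> subfield F R \<and> d ` F \<subseteq> F"

definition diff_field_generated :: "('a, 'b) ring_scheme \<Rightarrow> ('a \<Rightarrow> 'a) \<Rightarrow> 'a set \<Rightarrow> 'a set" where
  "diff_field_generated R d S = \<Inter> {F. diff_subfield R d F \<and> S \<subseteq> F}"

definition diff_hom ::
  "('a, 'm) ring_scheme \<Rightarrow> ('a \<Rightarrow> 'a) \<Rightarrow> ('b, 'n) ring_scheme \<Rightarrow> ('b \<Rightarrow> 'b) \<Rightarrow> ('a \<Rightarrow> 'b) \<Rightarrow> bool" where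
  "diff_hom R d S e h \<longleftrightarrow> h \<in> ring_hom R S \<and> (\<forall>x \<in> carrier R. h (d x) = e (h x))"

text \<open>
  Separability of a field extension in the sense of MacLane: in characteristic \<open>p\<close>, the
  \<open>p\<close>-th powers of elements that are linearly independent over \<open>F\<close> are again linearly
  independent over \<open>F\<close>.  In characteristic zero every extension is separable.
\<close>

definition separable_over :: "('a, 'b) ring_scheme \<Rightarrow> 'a set \<Rightarrow> bool" where
  "separable_over L F \<longleftrightarrow>
     (\<forall>p::nat. Factorial_Ring.prime p \<and> [p] \<cdot>\<^bsub>L\<^esub> \<one>\<^bsub>L\<^esub> = \<zero>\<^bsub>L\<^esub> \<longrightarrow>
        (\<forall>xs. set xs \<subseteq> carrier L \<and> ring.independent L F xs \<longrightarrow>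
              ring.independent L F (map (\<lambda>x. x [^]\<^bsub>L\<^esub> p) xs)))"

text \<open>
  Universal differential extension (Kolchin): for every finitely generated differential
  extension field \<open>F = K\<langle>S\<rangle>\<close> of \<open>K\<close> inside the universe, each finitely generated separable
  differential extension field of \<open>F\<close> embeds into the universe over \<open>F\<close>.  In characteristic
  zero the word separable may be dropped.

  The universe is the whole type \<open>'a\<close>.  The abstract extension \<open>h : F \<rightarrow> L\<close> ranges over fields
  whose carrier is a set of elements of the same type \<open>'a\<close>.  This loses no extension up to
  isomorphism: a finitely generated differential extension of \<open>F\<close> has cardinality at most
  \<open>max |F| \<aleph>\<^sub>0\<close>, and this is at most the cardinality of \<open>'a\<close> whenever \<open>'a\<close> is infinite, which it
  is as soon as it contains a differential indeterminate.
\<close>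

definition universal_diff_extension :: "('a::Fields.field \<Rightarrow> 'a) \<Rightarrow> 'a set \<Rightarrow> bool" where
  "universal_diff_extension d K \<longleftrightarrow>
     (let E = (ring_of_type_algebra :: 'a ring) in
      diff_field E d \<and> diff_subfield E d K \<and>
      (\<forall>S F. finite S \<and> F = diff_field_generated E d (K \<union> S) \<longrightarrow>
        (\<forall>(L :: 'a ring) d\<^sub>L h T.
           diff_field L d\<^sub>L \<and> diff_hom (E \<lparr>carrier := F\<rparr>) d L d\<^sub>L h \<and>
           finite T \<and> T \<subseteq> carrier L \<and>
           carrier L = diff_field_generated L d\<^sub>L (h ` F \<union> T) \<and>
           separable_over L (h ` F) \<longrightarrow>
           (\<exists>g. diff_hom L d\<^sub>L E d g \<and> (\<forall>x \<in> F. g (h x) = x)))))"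


section \<open>Differential polynomials\<close>

text \<open>
  A differential polynomial is an ordinary polynomial in the variables \<open>(i, k)\<close>, where \<open>(i, k)\<close>
  stands for the \<open>k\<close>-th derivative of the \<open>i\<close>-th differential indeterminate.
\<close>

type_synonym 'a dpoly = "((nat \<times> nat) \<Rightarrow>\<^sub>0 nat) \<Rightarrow>\<^sub>0 'a"

definition dpolys :: "'a::zero set \<Rightarrow> nat set \<Rightarrow> 'a dpoly set" where
  "dpolys K I = {f. (\<forall>m. Poly_Mapping.lookup f m \<in> K) \<and>
                    (\<forall>m \<in> Poly_Mapping.keys f. Poly_Mapping.keys m \<subseteq> I \<times> UNIV)}"

definition dconst :: "'a::zero \<Rightarrow> 'a dpoly" where
  "dconst c = Poly_Mapping.single 0 c"

definition dvar :: "nat \<Rightarrow> nat \<Rightarrow> 'a::zero_neq_one dpoly" where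
  "dvar i k = Poly_Mapping.single (Poly_Mapping.single (i, k) 1) 1"

definition dpoly_eval :: "('a::comm_semiring_1 \<Rightarrow> 'a) \<Rightarrow> 'a dpoly \<Rightarrow> (nat \<Rightarrow> 'a) \<Rightarrow> 'a" where
  "dpoly_eval d f x = (\<Sum>m \<in> Poly_Mapping.keys f. Poly_Mapping.lookup f m *
     (\<Prod>(i, k) \<in> Poly_Mapping.keys m. ((d ^^ k) (x i)) ^ Poly_Mapping.lookup m (i, k)))"

definition diff_indeterminates ::
  "('a::comm_semiring_1 \<Rightarrow> 'a) \<Rightarrow> 'a set \<Rightarrow> nat set \<Rightarrow> (nat \<Rightarrow> 'a) \<Rightarrow> bool" where
  "diff_indeterminates d K I u \<longleftrightarrow> (\<forall>f \<in> dpolys K I. dpoly_eval d f u = 0 \<longrightarrow> f = 0)"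


section \<open>Linear differential operators\<close>

text \<open>
  The operator \<open>\<Sum>k. c\<^sub>k \<partial>\<^sup>k\<close> is represented by its coefficients, written on the left, as an
  element of type \<open>'a poly\<close>; only the additive structure of that type is used, the product of
  operators is the skew product determined by \<open>\<partial> c = c \<partial> + d c\<close>.
\<close>

definition del_mult :: "('a::comm_ring_1 \<Rightarrow> 'a) \<Rightarrow> 'a poly \<Rightarrow> 'a poly" where
  "del_mult d Q = pCons 0 Q + map_poly d Q"

definition op_mult :: "('a::comm_ring_1 \<Rightarrow> 'a) \<Rightarrow> 'a poly \<Rightarrow> 'a poly \<Rightarrow> 'a poly" where
  "op_mult d P Q =
     (\<Sum>k \<le> Polynomial.degree P. Polynomial.smult (Polynomial.coeff P k) ((del_mult d ^^ k) Q))"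

definition diff_ops :: "('a::comm_ring_1 \<Rightarrow> 'a) \<Rightarrow> 'a set \<Rightarrow> 'a poly ring" where
  "diff_ops d K = \<lparr>carrier = {P. \<forall>k. Polynomial.coeff P k \<in> K},
     monoid.mult = op_mult d, one = 1, ring.zero = 0, add = (+)\<rparr>"

text \<open>The differential polynomial \<open>L(u\<^sub>j)\<close>.\<close>

definition op_dpoly :: "'a::comm_ring_1 poly \<Rightarrow> nat \<Rightarrow> 'a dpoly" where
  "op_dpoly L j = (\<Sum>k \<le> Polynomial.degree L. dconst (Polynomial.coeff L k) * dvar j k)"

definition right_divides :: "('a, 'b) ring_scheme \<Rightarrow> 'a \<Rightarrow> 'a \<Rightarrow> bool" where
  "right_divides R b a \<longleftrightarrow> (\<exists>q \<in> carrier R. a = q \<otimes>\<^bsub>R\<^esub> b)"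

definition is_right_gcd :: "('a, 'b) ring_scheme \<Rightarrow> 'a set \<Rightarrow> 'a \<Rightarrow> bool" where
  "is_right_gcd R A g \<longleftrightarrow> g \<in> carrier R \<and> (\<forall>a \<in> A. right_divides R g a) \<and>
     (\<forall>h \<in> carrier R. (\<forall>a \<in> A. right_divides R h a) \<longrightarrow> right_divides R h g)"

text \<open>
  A greatest common right divisor is unique only up to a nonzero factor from \<open>K\<close> on the left, so
  one of them lies in \<open>K\<close> iff all of them do.
\<close>

definition right_coprime :: "('a::comm_ring_1 \<Rightarrow> 'a) \<Rightarrow> 'a set \<Rightarrow> 'a poly set \<Rightarrow> bool" where
  "right_coprime d K A \<longleftrightarrow> (\<exists>c \<in> K. c \<noteq> 0 \<and> is_right_gcd (diff_ops d K) A [:c:])"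


section \<open>Parametric equations\<close>

text \<open>
  For \<open>x\<^sub>i = P\<^sub>i(U)\<close>, \<open>i = 1, \<dots>, n\<close>, in the parameters \<open>u\<^sub>1, \<dots>, u\<^bsub>n-1\<^esub>\<close>.  The indeterminates \<open>U\<close>
  are elements \<open>u i\<close> of the universe, so that \<open>K{U}\<close> is a subring of the universe and substitution
  into a differential polynomial is evaluation.
\<close>

definition implicit_ideal ::
  "('a::comm_semiring_1 \<Rightarrow> 'a) \<Rightarrow> 'a set \<Rightarrow> nat \<Rightarrow> (nat \<Rightarrow> 'a) \<Rightarrow> (nat \<Rightarrow> 'a dpoly) \<Rightarrow> 'a dpoly set" where
  "implicit_ideal d K n u P =
     {f \<in> dpolys K {1..n}. dpoly_eval d f (\<lambda>i. dpoly_eval d (P i) u) = 0}"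

definition generic_zero ::
  "('a::comm_semiring_1 \<Rightarrow> 'a) \<Rightarrow> 'a set \<Rightarrow> nat \<Rightarrow> 'a dpoly set \<Rightarrow> (nat \<Rightarrow> 'a) \<Rightarrow> bool" where
  "generic_zero d K n J \<Gamma> \<longleftrightarrow> {f \<in> dpolys K {1..n}. dpoly_eval d f \<Gamma> = 0} = J"

text \<open>
  A point of affine \<open>m\<close>-space is a function on \<open>{1..m}\<close>, extended by \<open>undefined\<close> so that points
  with equal coordinates are equal.  The unique parameter value is required for some generic zero;
  demanding it for every generic zero implies this, because \<open>(P\<^sub>1(U), \<dots>, P\<^sub>n(U))\<close> is one.
\<close>

definition proper_system ::
  "('a::comm_semiring_1 \<Rightarrow> 'a) \<Rightarrow> 'a set \<Rightarrow> nat \<Rightarrow> (nat \<Rightarrow> 'a) \<Rightarrow> (nat \<Rightarrow> 'a dpoly) \<Rightarrow> bool" where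
  "proper_system d K n u P \<longleftrightarrow>
     (\<exists>\<Gamma> \<in> {1..n} \<rightarrow>\<^sub>E UNIV. generic_zero d K n (implicit_ideal d K n u P) \<Gamma> \<and>
        (\<exists>!\<tau>. \<tau> \<in> {1..n-1} \<rightarrow>\<^sub>E UNIV \<and> (\<forall>i \<in> {1..n}. \<Gamma> i = dpoly_eval d (P i) \<tau>)))"

end

theory Submission
  imports Defs
begin

text \<open>
  Let \<open>h\<close> be a common right divisor of the operators \<open>L\<^bsub>1j\<^esub>, \<dots>, L\<^bsub>nj\<^esub>\<close> of positive order.  If \<open>v\<close> is a
  nonzero solution of \<open>h(v) = 0\<close> in the universe, then every \<open>L\<^bsub>ij\<^esub>\<close> annihilates \<open>v\<close>, so adding \<open>v\<close>
  to the \<open>j\<close>-th parameter leaves all \<open>P\<^sub>i\<close> unchanged.  Then no point has exactly one parameter value,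
  and the system is not proper.  For a proper system all common right divisors therefore have order
  zero; as not all \<open>L\<^bsub>ij\<^esub>\<close> vanish, this is coprimality (\<open>right_coprimeI\<close>).

  The substance is the existence of \<open>v\<close> (\<open>universal_solution\<close>).  A solution with algebraically
  independent derivatives of order less than \<open>m\<close>, where \<open>m\<close> is the order of \<open>h\<close>, lives in a field of
  rational functions in \<open>m\<close> variables over \<open>K\<close>, whose derivation is dictated by the equation
  \<open>h(v) = 0\<close>.  Such a field is realised inside the universe by the derivatives of a differential
  indeterminate, which are algebraically independent over \<open>K\<close> (\<open>derivatives_transcendental\<close>), and
  it is given a new derivation (\<open>derivation_extends_to_tower\<close>).  The resulting differential field is
  finitely generated, and universality embeds it into the universe over \<open>K\<close>, provided that it is
  separable over \<open>K\<close>.  The characteristic is arbitrary, so separability of a purely transcendental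
  extension in the sense of MacLane is proved as well (\<open>separable_over_tower\<close>).
\<close>

section \<open>Subfields and towers of simple extensions\<close>

definition ring_closed :: "'a::Fields.field set \<Rightarrow> bool" where
  "ring_closed R \<longleftrightarrow> 1 \<in> R \<and> (\<forall>x \<in> R. - x \<in> R) \<and>
     (\<forall>x \<in> R. \<forall>y \<in> R. x + y \<in> R \<and> x * y \<in> R)"

definition field_closed :: "'a::Fields.field set \<Rightarrow> bool" where
  "field_closed F \<longleftrightarrow> ring_closed F \<and> (\<forall>x \<in> F. inverse x \<in> F)"

lemma ring_closedD:
  assumes "ring_closed R"
  shows "1 \<in> R" "0 \<in> R" "\<And>x. x \<in> R \<Longrightarrow> - x \<in> R"
    "\<And>x y. x \<in> R \<Longrightarrow> y \<in> R \<Longrightarrow> x + y \<in> R" "\<And>x y. x \<in> R \<Longrightarrow> y \<in> R \<Longrightarrow> x * y \<in> R"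
    "\<And>x y. x \<in> R \<Longrightarrow> y \<in> R \<Longrightarrow> x - y \<in> R"
    "\<And>x k. x \<in> R \<Longrightarrow> x ^ k \<in> R"
    "\<And>f A. (\<And>i. i \<in> A \<Longrightarrow> f i \<in> R) \<Longrightarrow> sum f A \<in> R"
proof -
  show one: "1 \<in> R" and neg: "\<And>x. x \<in> R \<Longrightarrow> - x \<in> R"
    and add: "\<And>x y. x \<in> R \<Longrightarrow> y \<in> R \<Longrightarrow> x + y \<in> R"
    and mult: "\<And>x y. x \<in> R \<Longrightarrow> y \<in> R \<Longrightarrow> x * y \<in> R"
    using assms by (auto simp: ring_closed_def)
  show zero: "0 \<in> R" using add[OF one neg[OF one]] by simp
  show "\<And>x y. x \<in> R \<Longrightarrow> y \<in> R \<Longrightarrow> x - y \<in> R" using add neg by (metis diff_conv_add_uminus)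
  show "x ^ k \<in> R" if "x \<in> R" for x k using that by (induction k) (auto simp: one mult)
  show "sum f A \<in> R" if "\<And>i. i \<in> A \<Longrightarrow> f i \<in> R" for f :: "'b \<Rightarrow> 'a" and A
    using that by (induction A rule: infinite_finite_induct) (auto simp: zero add)
qed

lemma field_closedD:
  assumes "field_closed F"
  shows "ring_closed F" "\<And>x. x \<in> F \<Longrightarrow> inverse x \<in> F"
    "\<And>x y. x \<in> F \<Longrightarrow> y \<in> F \<Longrightarrow> x / y \<in> F"
  using assms by (auto simp: field_closed_def divide_inverse intro: ring_closedD(5))

text \<open>
  Most of the argument takes place inside one field type and speaks of subsets closed under its
  operations.  Universality quantifies over fields given by a carrier; a subset \<open>T\<close> becomes such a
  field when the carrier of the universe is replaced by \<open>T\<close>.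
\<close>

abbreviation universe_ring :: "'a::Fields.field set \<Rightarrow> 'a ring" where
  "universe_ring T \<equiv> (ring_of_type_algebra :: 'a ring)\<lparr>carrier := T\<rparr>"

lemma universe_ring_simps [simp]:
  "carrier ring_of_type_algebra = UNIV" "x \<otimes>\<^bsub>ring_of_type_algebra\<^esub> y = x * y"
  "x \<oplus>\<^bsub>ring_of_type_algebra\<^esub> y = x + y"
  "\<one>\<^bsub>ring_of_type_algebra\<^esub> = 1" "\<zero>\<^bsub>ring_of_type_algebra\<^esub> = 0"
  by (simp_all add: ring_of_type_algebra_def)

lemma universe_ring_UNIV: "universe_ring UNIV = ring_of_type_algebra"
  by (simp add: ring_of_type_algebra_def)

lemma field_universe_ring:
  assumes "field_closed T"
  shows "field (universe_ring T)"
proof -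
  note R = field_closedD(1)[OF assms]
  have "\<exists>y \<in> T. x + y = 0" if "x \<in> T" for x using ring_closedD(3)[OF R that] by force
  moreover have "\<exists>y \<in> T. x * y = 1" if "x \<in> T" "x \<noteq> 0" for x
    using field_closedD(2)[OF assms that(1)] that(2) by force
  moreover have "\<exists>y \<in> T. y + x = 0" if "x \<in> T" for x using ring_closedD(3)[OF R that] by force
  ultimately show ?thesis using ring_closedD[OF R]
    by unfold_locales (auto simp: algebra_simps Units_def)
qed

lemma subfield_universe_ring_iff:
  assumes T: "field_closed T"
  shows "subfield Q (universe_ring T) \<longleftrightarrow> field_closed Q \<and> Q \<subseteq> T"
proof -
  interpret R: field "universe_ring T" by (rule field_universe_ring[OF T])
  have neg: "\<ominus>\<^bsub>universe_ring T\<^esub> x = - x" if "x \<in> T" for x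
    using R.minus_equality[of "- x" x] that ring_closedD(3)[OF field_closedD(1)[OF T] that] by simp
  have inv: "inv\<^bsub>universe_ring T\<^esub> x = inverse x" if "x \<in> T" "x \<noteq> 0" for x
    using R.inv_unique'[of x "inverse x"] that field_closedD(2)[OF T that(1)] by simp
  show ?thesis
  proof
    assume Q: "subfield Q (universe_ring T)"
    note S = subringE[OF subfieldE(1)[OF Q]]
    have sub: "Q \<subseteq> T" using subfieldE(3)[OF Q] by simp
    have "- x \<in> Q" if "x \<in> Q" for x using S(5)[OF that] neg that sub by auto
    moreover have "inverse x \<in> Q" if "x \<in> Q" for x
    proof (cases "x = 0")
      case False
      then show ?thesis using R.subfield_m_inv(1)[OF Q, of x] inv[of x] that sub by auto
    qed (use that in simp)
    ultimately show "field_closed Q \<and> Q \<subseteq> T"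
      using S(3,6,7) sub by (auto simp: field_closed_def ring_closed_def)
  next
    assume Q: "field_closed Q \<and> Q \<subseteq> T"
    note S = ring_closedD[OF field_closedD(1)] field_closedD(2)
    show "subfield Q (universe_ring T)"
    proof (rule R.subfieldI')
      show "subring Q (universe_ring T)"
        by (rule R.subringI) (use Q S neg[OF subsetD[of Q]] in auto)
    next
      fix k assume "k \<in> Q - {\<zero>\<^bsub>universe_ring T\<^esub>}"
      then show "inv\<^bsub>universe_ring T\<^esub> k \<in> Q" using inv[of k] Q S(9)[of Q k] by auto
    qed
  qed
qed

definition fractions :: "'a::Fields.field set \<Rightarrow> 'a set" where
  "fractions R = {a / b | a b. a \<in> R \<and> b \<in> R \<and> b \<noteq> 0}"

lemma subset_fractions: "ring_closed R \<Longrightarrow> R \<subseteq> fractions R"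
proof
  fix x assume "ring_closed R" "x \<in> R"
  then show "x \<in> fractions R"
    unfolding fractions_def using ring_closedD(1)[of R]
    by (intro CollectI exI[of _ x] exI[of _ 1]) simp
qed

lemma fractions_subset: "field_closed F \<Longrightarrow> R \<subseteq> F \<Longrightarrow> fractions R \<subseteq> F"
  unfolding fractions_def using field_closedD(3)[of F] by auto

lemma field_closed_fractions:
  assumes "ring_closed R"
  shows "field_closed (fractions R)"
proof -
  note R = ring_closedD[OF assms]
  have one: "1 \<in> fractions R" using subset_fractions[OF assms] R(1) by blast
  have neg: "- x \<in> fractions R" if "x \<in> fractions R" for x
  proof -
    obtain a b where "x = a / b" "a \<in> R" "b \<in> R" "b \<noteq> 0" using \<open>x \<in> fractions R\<close> by (auto simp: fractions_def)
    then show ?thesis unfolding fractions_def using R(3)[of a]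
      by (intro CollectI exI[of _ "- a"] exI[of _ b]) simp
  qed
  have inv: "inverse x \<in> fractions R" if x: "x \<in> fractions R" for x
  proof -
    obtain a b where ab: "x = a / b" "a \<in> R" "b \<in> R" "b \<noteq> 0" using x by (auto simp: fractions_def)
    show ?thesis
    proof (cases "a = 0")
      case True
      then show ?thesis using x ab by simp
    next
      case False
      then have "inverse x = b / a" using ab by simp
      then show ?thesis using False ab by (auto simp: fractions_def)
    qed
  qed
  have "x + y \<in> fractions R \<and> x * y \<in> fractions R" if xy: "x \<in> fractions R" "y \<in> fractions R" for x y
  proof -
    obtain a b where ab: "x = a / b" "a \<in> R" "b \<in> R" "b \<noteq> 0" using xy(1) by (auto simp: fractions_def)
    obtain a' b' where ab': "y = a' / b'" "a' \<in> R" "b' \<in> R" "b' \<noteq> 0"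
      using xy(2) by (auto simp: fractions_def)
    have "x + y = (a * b' + a' * b) / (b * b')" "x * y = (a * a') / (b * b')" "b * b' \<noteq> 0"
      using ab ab' by (auto simp: field_simps)
    then show ?thesis
      unfolding fractions_def using R(4,5) ab(2,3) ab'(2,3) by blast
  qed
  then show ?thesis using one neg inv by (auto simp: field_closed_def ring_closed_def)
qed

text \<open>
  Clearing denominators: a statement about finitely many elements of the fraction field is reduced
  to one about the ring.  It is used for the coefficients of a polynomial and for the entries of a
  column of rational functions.
\<close>

lemma common_denominator:
  assumes "ring_closed R" "finite A" "A \<subseteq> fractions R"
  obtains b where "b \<in> R" "b \<noteq> 0" "\<And>x. x \<in> A \<Longrightarrow> b * x \<in> R"
proof -
  have "\<exists>b \<in> R. b \<noteq> 0 \<and> (\<forall>x \<in> A. b * x \<in> R)"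
    using assms(2,3)
  proof (induction A)
    case empty
    then show ?case using ring_closedD(1)[OF assms(1)] by (intro bexI[of _ 1]) auto
  next
    case (insert x A)
    then obtain b where b: "b \<in> R" "b \<noteq> 0" "\<forall>x \<in> A. b * x \<in> R" by auto
    obtain p q where pq: "x = p / q" "p \<in> R" "q \<in> R" "q \<noteq> 0"
      using insert.prems by (auto simp: fractions_def)
    have "(b * q) * x = b * p" using pq by simp
    moreover have "(b * q) * z = q * (b * z)" for z by simp
    ultimately have "\<forall>z \<in> insert x A. (b * q) * z \<in> R"
      using b pq ring_closedD(5)[OF assms(1)] by (metis insert_iff)
    then show ?case using b pq ring_closedD(5)[OF assms(1)] by (intro bexI[of _ "b * q"]) auto
  qed
  then show thesis using that by blast
qed

definition polys_over :: "'a::zero set \<Rightarrow> 'a poly set" where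
  "polys_over F = {p. \<forall>k. Polynomial.coeff p k \<in> F}"

definition adjoin :: "'a::Fields.field set \<Rightarrow> 'a \<Rightarrow> 'a set" where
  "adjoin F t = fractions ((\<lambda>p. poly p t) ` polys_over F)"

definition transcendental_over :: "'a::Fields.field set \<Rightarrow> 'a \<Rightarrow> bool" where
  "transcendental_over F t \<longleftrightarrow> (\<forall>p \<in> polys_over F. poly p t = 0 \<longrightarrow> p = 0)"

lemma polys_over_closed:
  assumes "ring_closed F"
  shows "\<And>a. a \<in> F \<Longrightarrow> [:a:] \<in> polys_over F" "[:0, 1:] \<in> polys_over F"
    "\<And>p. p \<in> polys_over F \<Longrightarrow> - p \<in> polys_over F"
    "\<And>p q. p \<in> polys_over F \<Longrightarrow> q \<in> polys_over F \<Longrightarrow> p + q \<in> polys_over F"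
    "\<And>p q. p \<in> polys_over F \<Longrightarrow> q \<in> polys_over F \<Longrightarrow> p - q \<in> polys_over F"
    "\<And>p q. p \<in> polys_over F \<Longrightarrow> q \<in> polys_over F \<Longrightarrow> p * q \<in> polys_over F"
  using ring_closedD[OF assms]
  by (auto simp: polys_over_def coeff_mult coeff_pCons intro!: ring_closedD(8)[OF assms] split: nat.split)

lemma ring_closed_poly_values:
  assumes "ring_closed F"
  shows "ring_closed ((\<lambda>p. poly p t) ` polys_over F)"
proof -
  note P = polys_over_closed[OF assms]
  have "poly 1 t = 1" "(1 :: 'a poly) \<in> polys_over F"
    using P(1)[OF ring_closedD(1)[OF assms]] by (auto simp: one_pCons)
  then have "1 \<in> (\<lambda>p. poly p t) ` polys_over F" by (metis imageI)
  moreover have "- x \<in> (\<lambda>p. poly p t) ` polys_over F" if "x \<in> (\<lambda>p. poly p t) ` polys_over F" for x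
    using that P(3) by (auto simp flip: poly_minus)
  moreover have "x + y \<in> (\<lambda>p. poly p t) ` polys_over F \<and> x * y \<in> (\<lambda>p. poly p t) ` polys_over F"
    if "x \<in> (\<lambda>p. poly p t) ` polys_over F" "y \<in> (\<lambda>p. poly p t) ` polys_over F" for x y
    using that P(4,6) by (auto simp flip: poly_add poly_mult)
  ultimately show ?thesis by (simp add: ring_closed_def)
qed

lemma field_closed_adjoin: "field_closed F \<Longrightarrow> field_closed (adjoin F t)"
  unfolding adjoin_def by (intro field_closed_fractions ring_closed_poly_values field_closedD)

lemma poly_in_adjoin: "field_closed F \<Longrightarrow> p \<in> polys_over F \<Longrightarrow> poly p t \<in> adjoin F t"
  unfolding adjoin_def
  using subset_fractions[OF ring_closed_poly_values[OF field_closedD(1)], of F t] by auto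

lemma subset_adjoin: "field_closed F \<Longrightarrow> F \<subseteq> adjoin F t"
  using poly_in_adjoin[OF _ polys_over_closed(1)[OF field_closedD(1)], of F _ t] by auto

lemma generator_in_adjoin: "field_closed F \<Longrightarrow> t \<in> adjoin F t"
  using poly_in_adjoin[OF _ polys_over_closed(2)[OF field_closedD(1)], of F t] by simp

lemma adjoin_subset:
  assumes "field_closed M" "F \<subseteq> M" "t \<in> M"
  shows "adjoin F t \<subseteq> M"
  unfolding adjoin_def
proof (rule fractions_subset[OF assms(1)], safe)
  fix p assume "p \<in> polys_over F"
  then show "poly p t \<in> M"
    unfolding poly_altdef using assms
    by (intro ring_closedD(5,7,8)[OF field_closedD(1)[OF assms(1)]]) (auto simp: polys_over_def)
qed

text \<open>
  The field \<open>K(y\<^sub>0, \<dots>, y\<^bsub>m-1\<^esub>)\<close>, built one generator at a time so that statements about rational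
  functions in several variables reduce, by induction, to statements about one variable.
\<close>

primrec tower :: "'a::Fields.field set \<Rightarrow> (nat \<Rightarrow> 'a) \<Rightarrow> nat \<Rightarrow> 'a set" where
  "tower K y 0 = K"
| "tower K y (Suc m) = adjoin (tower K y m) (y m)"

lemma field_closed_tower: "field_closed K \<Longrightarrow> field_closed (tower K y m)"
  by (induction m) (auto intro: field_closed_adjoin)

lemma base_subset_tower: "field_closed K \<Longrightarrow> K \<subseteq> tower K y m"
proof (induction m)
  case (Suc m)
  then show ?case using subset_adjoin[OF field_closed_tower[of K y m], of "y m"] by auto
qed simp

lemma generator_in_tower: "field_closed K \<Longrightarrow> k < m \<Longrightarrow> y k \<in> tower K y m"
proof (induction m)
  case (Suc m)
  then show ?case
    using subset_adjoin[OF field_closed_tower, of K y m "y m"] generator_in_adjoin[OF field_closed_tower]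
    by (cases "k = m") auto
qed simp

lemma tower_subset:
  assumes "field_closed M" "K \<subseteq> M" "\<And>k. k < m \<Longrightarrow> y k \<in> M"
  shows "tower K y m \<subseteq> M"
  using assms(3)
proof (induction m)
  case (Suc m)
  then show ?case using adjoin_subset[OF assms(1)] by simp
qed (simp add: assms(2))

section \<open>Extending derivations along a purely transcendental tower\<close>

definition derivation_on :: "'a::Fields.field set \<Rightarrow> ('a \<Rightarrow> 'a) \<Rightarrow> bool" where
  "derivation_on F D \<longleftrightarrow>
     (\<forall>x \<in> F. \<forall>y \<in> F. D (x + y) = D x + D y \<and> D (x * y) = D x * y + x * D y)"

lemma derivation_on_simps:
  assumes F: "ring_closed F" and D: "derivation_on F D"
  shows "D 0 = 0" "D 1 = 0" "\<And>x. x \<in> F \<Longrightarrow> D (- x) = - D x"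
    "\<And>f A. (\<And>i. i \<in> A \<Longrightarrow> f i \<in> F) \<Longrightarrow> D (sum f A) = (\<Sum>i\<in>A. D (f i))"
    "\<And>x. x \<in> F \<Longrightarrow> inverse x \<in> F \<Longrightarrow> x \<noteq> 0 \<Longrightarrow> D (inverse x) = - D x / x\<^sup>2"
proof -
  note R = ring_closedD[OF F]
  have add: "D (x + y) = D x + D y" and mult: "D (x * y) = D x * y + x * D y"
    if "x \<in> F" "y \<in> F" for x y using D that by (auto simp: derivation_on_def)
  have "D 0 + 0 = D 0 + D 0" using add[OF R(2) R(2)] by simp
  then show zero: "D 0 = 0" by (metis add_left_imp_eq)
  have "D 1 + 0 = D 1 + D 1" using mult[OF R(1) R(1)] by simp
  then show one: "D 1 = 0" by (metis add_left_imp_eq)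
  show neg: "D (- x) = - D x" if "x \<in> F" for x
    using add[OF that R(3)[OF that]] zero by (simp add: eq_neg_iff_add_eq_0 add.commute)
  show "D (sum f A) = (\<Sum>i\<in>A. D (f i))" if "\<And>i. i \<in> A \<Longrightarrow> f i \<in> F" for f :: "'b \<Rightarrow> 'a" and A
    using that by (induction A rule: infinite_finite_induct) (auto simp: zero add R(8))
  show "D (inverse x) = - D x / x\<^sup>2" if x: "x \<in> F" "inverse x \<in> F" "x \<noteq> 0" for x
  proof -
    have "D x * inverse x + x * D (inverse x) = 0" using mult[OF x(1,2)] x(3) one by simp
    then have "x * D (inverse x) = - (D x * inverse x)" by (simp add: add_eq_0_iff)
    then have "D (inverse x) = - (D x * inverse x) / x" using x(3) by (simp add: field_simps)
    then show ?thesis using x(3) by (simp add: power2_eq_square field_simps)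
  qed
qed

text \<open>
  For a polynomial \<open>p\<close> over a field with derivation \<open>D\<close>, this is the only possible value at \<open>p(t)\<close> of
  a derivation that extends \<open>D\<close> and sends \<open>t\<close> to \<open>s\<close>: differentiate the coefficients, and apply the
  chain rule to the powers of \<open>t\<close>.
\<close>

definition poly_deriv_at :: "('a::Fields.field \<Rightarrow> 'a) \<Rightarrow> 'a \<Rightarrow> 'a \<Rightarrow> 'a poly \<Rightarrow> 'a" where
  "poly_deriv_at D t s p = poly (map_poly D p) t + poly (pderiv p) t * s"

lemma poly_deriv_at_add_mult:
  assumes F: "ring_closed F" and D: "derivation_on F D"
    and p: "p \<in> polys_over F" and q: "q \<in> polys_over F"
  shows "poly_deriv_at D t s (p + q) = poly_deriv_at D t s p + poly_deriv_at D t s q"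
    and "poly_deriv_at D t s (p * q) =
      poly_deriv_at D t s p * poly q t + poly p t * poly_deriv_at D t s q"
proof -
  note D0 = derivation_on_simps(1)[OF F D]
  have c: "Polynomial.coeff p k \<in> F" "Polynomial.coeff q k \<in> F" for k
    using p q by (auto simp: polys_over_def)
  have "map_poly D (p + q) = map_poly D p + map_poly D q"
    using D c by (intro poly_eqI) (simp add: coeff_map_poly D0 derivation_on_def)
  then show "poly_deriv_at D t s (p + q) = poly_deriv_at D t s p + poly_deriv_at D t s q"
    by (simp add: poly_deriv_at_def pderiv_add algebra_simps)
  have "map_poly D (p * q) = map_poly D p * q + p * map_poly D q"
  proof (rule poly_eqI)
    fix k
    have "D (\<Sum>i\<le>k. Polynomial.coeff p i * Polynomial.coeff q (k - i))
      = (\<Sum>i\<le>k. D (Polynomial.coeff p i * Polynomial.coeff q (k - i)))"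
      by (intro derivation_on_simps(4)[OF F D]) (use c ring_closedD(5)[OF F] in auto)
    also have "\<dots> = (\<Sum>i\<le>k. D (Polynomial.coeff p i) * Polynomial.coeff q (k - i)
         + Polynomial.coeff p i * D (Polynomial.coeff q (k - i)))"
      using D c by (simp add: derivation_on_def)
    finally show "Polynomial.coeff (map_poly D (p * q)) k
      = Polynomial.coeff (map_poly D p * q + p * map_poly D q) k"
      by (simp add: coeff_map_poly D0 coeff_mult sum.distrib)
  qed
  then show "poly_deriv_at D t s (p * q) =
      poly_deriv_at D t s p * poly q t + poly p t * poly_deriv_at D t s q"
    by (simp add: poly_deriv_at_def pderiv_mult algebra_simps)
qed

text \<open>
  The value at \<open>p(t) / q(t)\<close> is forced by the quotient rule.  Two representations of the same element
  satisfy \<open>p q' = p' q\<close> as polynomials, because \<open>t\<close> is transcendental, and comparing the derivatives of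
  both sides shows that the quotient rule gives the same value for both.
\<close>

lemma derivation_extends_to_adjoin:
  assumes F: "field_closed F" and D: "derivation_on F D" and t: "transcendental_over F t"
  obtains D' where "derivation_on (adjoin F t) D'" "\<And>x. x \<in> F \<Longrightarrow> D' x = D x" "D' t = s"
proof -
  note R = field_closedD(1)[OF F]
  note P = polys_over_closed[OF R]
  note add = poly_deriv_at_add_mult(1)[OF R D] and mult = poly_deriv_at_add_mult(2)[OF R D]
  let ?\<delta> = "poly_deriv_at D t s"
  let ?quot = "\<lambda>p q. (?\<delta> p * poly q t - poly p t * ?\<delta> q) / (poly q t)\<^sup>2"
  have well_defined: "?quot p q = ?quot p' q'"
    if pq: "p \<in> polys_over F" "q \<in> polys_over F" "poly q t \<noteq> 0"
      and pq': "p' \<in> polys_over F" "q' \<in> polys_over F" "poly q' t \<noteq> 0"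
      and eq: "poly p t / poly q t = poly p' t / poly q' t" for p q p' q'
  proof -
    have "poly (p * q' - p' * q) t = 0" using eq pq(3) pq'(3) by (simp add: field_simps)
    then have *: "p * q' = p' * q"
      using t P(5,6) pq pq' unfolding transcendental_over_def by (metis eq_iff_diff_eq_0)
    define A B A' B' a b a' b' where defs: "A = poly p t" "B = poly q t" "A' = poly p' t"
      "B' = poly q' t" "a = ?\<delta> p" "b = ?\<delta> q" "a' = ?\<delta> p'" "b' = ?\<delta> q'"
    have e1: "A * B' = A' * B" unfolding defs using arg_cong[OF *, of "\<lambda>p. poly p t"] by simp
    have e2: "a * B' + A * b' = a' * B + A' * b"
      unfolding defs using arg_cong[OF *, of ?\<delta>] mult pq pq' by simp
    have nz: "B \<noteq> 0" "B' \<noteq> 0" using pq(3) pq'(3) by (auto simp: defs)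
    have "(a * B - A * b) * B'\<^sup>2 - (a' * B' - A' * b') * B\<^sup>2
      = B * B' * (a * B' + A * b' - (a' * B + A' * b)) - (A * B' - A' * B) * (b * B' + b' * B)"
      by (simp add: algebra_simps power2_eq_square)
    then have "(a * B - A * b) * B'\<^sup>2 = (a' * B' - A' * b') * B\<^sup>2"
      using e1 e2 by simp
    then have "(a * B - A * b) / B\<^sup>2 = (a' * B' - A' * b') / B'\<^sup>2"
      using nz by (simp add: frac_eq_eq)
    then show ?thesis unfolding defs .
  qed
  define rep where "rep x pq \<longleftrightarrow> fst pq \<in> polys_over F \<and> snd pq \<in> polys_over F \<and>
     poly (snd pq) t \<noteq> 0 \<and> x = poly (fst pq) t / poly (snd pq) t" for x pq
  define D' where "D' x = (let pq = SOME pq. rep x pq in ?quot (fst pq) (snd pq))" for x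
  have D'_quot: "D' (poly p t / poly q t) = ?quot p q"
    if pq: "p \<in> polys_over F" "q \<in> polys_over F" "poly q t \<noteq> 0" for p q
  proof -
    define r where "r = (SOME r. rep (poly p t / poly q t) r)"
    have "rep (poly p t / poly q t) (p, q)" using pq by (simp add: rep_def)
    then have r: "rep (poly p t / poly q t) r" unfolding r_def by (rule someI)
    have "D' (poly p t / poly q t) = ?quot (fst r) (snd r)" by (simp add: D'_def r_def Let_def)
    also have "\<dots> = ?quot p q"
      by (rule well_defined[OF _ _ _ pq]) (use r in \<open>simp_all add: rep_def\<close>)
    finally show ?thesis .
  qed
  have one: "1 \<in> polys_over F" using P(1)[OF ring_closedD(1)[OF R]] by (simp add: one_pCons)
  have \<delta>_one: "?\<delta> 1 = 0"
    using derivation_on_simps(2)[OF R D] by (simp add: poly_deriv_at_def map_poly_1)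
  have D'_poly: "D' (poly p t) = ?\<delta> p" if "p \<in> polys_over F" for p
    using D'_quot[OF that one] by (simp add: \<delta>_one)
  have "D' x = D x" if "x \<in> F" for x
    using D'_poly[OF P(1)[OF that]] derivation_on_simps(1)[OF R D]
    by (simp add: poly_deriv_at_def map_poly_pCons)
  moreover have "D' t = s"
    using D'_poly[OF P(2)] derivation_on_simps(1,2)[OF R D]
    by (simp add: poly_deriv_at_def map_poly_pCons pderiv_pCons)
  moreover
  have sum_rule: "((a * B' + A * b' + (a' * B + A' * b)) * (B * B') - (A * B' + A' * B) * (b * B' + B * b'))
      / (B * B')\<^sup>2 = (a * B - A * b) / B\<^sup>2 + (a' * B' - A' * b') / B'\<^sup>2"
    if "B \<noteq> 0" "B' \<noteq> 0" for A B a b A' B' a' b' :: 'a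
  proof -
    have "(a * B - A * b) / B\<^sup>2 + (a' * B' - A' * b') / B'\<^sup>2
      = ((a * B - A * b) * B'\<^sup>2 + (a' * B' - A' * b') * B\<^sup>2) / (B * B')\<^sup>2"
      using that by (simp add: add_frac_eq power_mult_distrib)
    then show ?thesis by (simp add: algebra_simps power2_eq_square)
  qed
  have product_rule: "((a * A' + A * a') * (B * B') - (A * A') * (b * B' + B * b')) / (B * B')\<^sup>2
      = (a * B - A * b) / B\<^sup>2 * (A' / B') + (A / B) * ((a' * B' - A' * b') / B'\<^sup>2)"
    if "B \<noteq> 0" "B' \<noteq> 0" for A B a b A' B' a' b' :: 'a
  proof -
    have "(a * B - A * b) / B\<^sup>2 * (A' / B') = ((a * B - A * b) * A' * B') / (B * B')\<^sup>2"
      "(A / B) * ((a' * B' - A' * b') / B'\<^sup>2) = (A * B * (a' * B' - A' * b')) / (B * B')\<^sup>2"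
      using that by (simp_all add: power2_eq_square)
    then show ?thesis by (simp add: algebra_simps power2_eq_square flip: add_divide_distrib)
  qed
  have "D' (x + y) = D' x + D' y \<and> D' (x * y) = D' x * y + x * D' y"
    if xy: "x \<in> adjoin F t" "y \<in> adjoin F t" for x y
  proof -
    obtain p q where pq: "p \<in> polys_over F" "q \<in> polys_over F" "poly q t \<noteq> 0"
      and x: "x = poly p t / poly q t" using xy(1) by (auto simp: adjoin_def fractions_def)
    obtain p' q' where pq': "p' \<in> polys_over F" "q' \<in> polys_over F" "poly q' t \<noteq> 0"
      and y: "y = poly p' t / poly q' t" using xy(2) by (auto simp: adjoin_def fractions_def)
    have "x + y = poly (p * q' + p' * q) t / poly (q * q') t"
      using pq(3) pq'(3) by (simp add: x y field_simps)
    then have "D' (x + y) = ?quot (p * q' + p' * q) (q * q')"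
      using D'_quot[of "p * q' + p' * q" "q * q'"] pq pq' P(4,6) by simp
    also have "\<dots> = ?quot p q + ?quot p' q'"
      using sum_rule[OF pq(3) pq'(3)] pq pq' P(6) by (simp add: add mult)
    finally have sum: "D' (x + y) = D' x + D' y" using D'_quot pq pq' by (simp add: x y)
    have "x * y = poly (p * p') t / poly (q * q') t" by (simp add: x y)
    then have "D' (x * y) = ?quot (p * p') (q * q')"
      using D'_quot[of "p * p'" "q * q'"] pq pq' P(6) by simp
    also have "\<dots> = ?quot p q * y + x * ?quot p' q'"
      using product_rule[OF pq(3) pq'(3)] pq pq' P(6) by (simp add: mult x y)
    finally show ?thesis using sum D'_quot pq pq' by (simp add: x y)
  qed
  ultimately show thesis using that[of D'] by (auto simp: derivation_on_def)
qed

text \<open>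
  The values \<open>s k\<close> need not lie in \<open>K(y\<^sub>0, \<dots>, y\<^sub>k)\<close>: the derivations on the intermediate fields take
  values in the whole universe.  This is what permits \<open>y\<^sub>k\<close> to be sent to \<open>y\<^bsub>k+1\<^esub>\<close>.
\<close>

lemma derivation_extends_to_tower:
  assumes K: "field_closed K" and D: "derivation_on K D"
    and "\<And>k. k < m \<Longrightarrow> transcendental_over (tower K y k) (y k)"
  obtains D' where "derivation_on (tower K y m) D'" "\<And>x. x \<in> K \<Longrightarrow> D' x = D x"
    "\<And>k. k < m \<Longrightarrow> D' (y k) = s k"
proof -
  have "\<exists>D'. derivation_on (tower K y m) D' \<and> (\<forall>x \<in> K. D' x = D x) \<and> (\<forall>k<m. D' (y k) = s k)"
    using assms(3)
  proof (induction m)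
    case 0
    then show ?case using D by auto
  next
    case (Suc m)
    then obtain D' where D': "derivation_on (tower K y m) D'" "\<forall>x \<in> K. D' x = D x"
      "\<forall>k<m. D' (y k) = s k" by force
    obtain D'' where "derivation_on (adjoin (tower K y m) (y m)) D''"
      "\<And>x. x \<in> tower K y m \<Longrightarrow> D'' x = D' x" "D'' (y m) = s m"
      using derivation_extends_to_adjoin[OF field_closed_tower[OF K] D'(1) Suc.prems[of m]] by blast
    then show ?case
      using D' base_subset_tower[OF K, of y m] generator_in_tower[OF K, of _ m y]
      by (intro exI[of _ D'']) (auto simp: less_Suc_eq)
  qed
  then show thesis using that by blast
qed

text \<open>
  The elements of the tower whose derivative stays in the tower form a field, which contains the
  generators.
\<close>

lemma derivation_preserves_tower:
  assumes K: "field_closed K" and D: "derivation_on (tower K y m) D"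
    and base: "D ` K \<subseteq> tower K y m" and gen: "\<And>k. k < m \<Longrightarrow> D (y k) \<in> tower K y m"
  shows "D ` tower K y m \<subseteq> tower K y m"
proof -
  let ?T = "tower K y m"
  note T = field_closed_tower[OF K, of y m]
  note R = ring_closedD[OF field_closedD(1)[OF T]]
  note DS = derivation_on_simps[OF field_closedD(1)[OF T] D]
  let ?M = "{x \<in> ?T. D x \<in> ?T}"
  have "D (inverse x) \<in> ?T" if "x \<in> ?M" for x
  proof (cases "x = 0")
    case False
    then show ?thesis using DS(5)[of x] that field_closedD(2,3)[OF T] R by auto
  qed (use R DS in auto)
  then have "field_closed ?M"
    using D R DS(2,3) field_closedD(2)[OF T]
    by (auto simp: field_closed_def ring_closed_def derivation_on_def)
  then have "?T \<subseteq> ?M"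
    by (rule tower_subset)
      (use base gen base_subset_tower[OF K, of y m] generator_in_tower[OF K, of _ m y] in auto)
  then show ?thesis by auto
qed

section \<open>Separability of purely transcendental extensions\<close>

text \<open>
  A form of separability of \<open>F\<close> over \<open>K\<close> that passes through towers.  If the \<open>p\<close>-th powers of some
  columns with entries in \<open>F\<close> satisfy a common nontrivial linear relation between their rows with
  coefficients in \<open>K\<close>, then so do the columns themselves.  MacLane's condition is the case of a single
  column.  Allowing an arbitrary set \<open>V\<close> of columns makes the induction work: an element of \<open>F(t)\<close> is
  replaced by the family of coefficients of its numerator.
\<close>

definition frobenius_descent :: "nat \<Rightarrow> 'a::Fields.field set \<Rightarrow> 'a set \<Rightarrow> bool" where
  "frobenius_descent p K F \<longleftrightarrow>
     (\<forall>(I::nat set) V c. finite I \<and> (\<forall>v\<in>V. \<forall>i\<in>I. v i \<in> F) \<and> (\<forall>i\<in>I. c i \<in> K) \<and>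
        (\<exists>i\<in>I. c i \<noteq> 0) \<and> (\<forall>v\<in>V. (\<Sum>i\<in>I. c i * v i ^ p) = 0) \<longrightarrow>
        (\<exists>c'. (\<forall>i\<in>I. c' i \<in> K) \<and> (\<exists>i\<in>I. c' i \<noteq> 0) \<and> (\<forall>v\<in>V. (\<Sum>i\<in>I. c' i * v i) = 0)))"

text \<open>
  Over \<open>K\<close> itself this says that applying the Frobenius endomorphism to the entries of a matrix does
  not lower its row rank.  The proof is Gaussian elimination on the columns, which commutes with the field
  homomorphism \<open>x \<mapsto> x^p\<close>; the induction is on the number of rows.
\<close>

lemma frobenius_descent_base:
  assumes K: "field_closed K" and p: "p = CHAR('a::Fields.field)" "Factorial_Ring.prime p"
  shows "frobenius_descent p K (K :: 'a set)"
proof -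
  note R = ring_closedD[OF field_closedD(1)[OF K]]
  have p0: "p > 0" using p(2) prime_gt_0_nat by blast
  have frob_diff: "(x - y) ^ p = x ^ p - y ^ p" for x y :: 'a
  proof -
    have "((x - y) + y) ^ p = (x - y) ^ p + y ^ p"
      by (rule freshmans_dream) (use p in auto)
    then show ?thesis by simp
  qed
  have "\<exists>c'. (\<forall>i\<in>I. c' i \<in> K) \<and> (\<exists>i\<in>I. c' i \<noteq> 0) \<and> (\<forall>v\<in>V. (\<Sum>i\<in>I. c' i * v i) = 0)"
    if "finite I" "\<forall>v\<in>V. \<forall>i\<in>I. v i \<in> K" "\<forall>i\<in>I. c i \<in> K" "\<exists>i\<in>I. c i \<noteq> 0"
      "\<forall>v\<in>V. (\<Sum>i\<in>I. c i * v i ^ p) = 0" for I :: "nat set" and V c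
    using that
  proof (induction "card I" arbitrary: I V c)
    case 0
    then show ?case by auto
  next
    case (Suc n)
    show ?case
    proof (cases "\<forall>v\<in>V. \<forall>i\<in>I. v i = 0")
      case True
      then show ?thesis using Suc.prems(4) R by (intro exI[of _ "\<lambda>_. 1"]) auto
    next
      case False
      then obtain w i0 where w: "w \<in> V" "i0 \<in> I" "w i0 \<noteq> 0" by blast
      define J where "J = I - {i0}"
      have J: "finite J" "card J = n" "I = insert i0 J" "i0 \<notin> J"
        using Suc.hyps(2) Suc.prems(1) w(2) by (auto simp: J_def card_Diff_singleton)
      \<comment> \<open>Subtract a multiple of the column \<open>w\<close> from every column, to make its entry at \<open>i0\<close> zero.\<close>
      define red where "red v i = v i - (v i0 / w i0) * w i" for v :: "nat \<Rightarrow> 'a" and i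
      have red0: "red v i0 = 0" for v using w(3) by (simp add: red_def)
      have red_sum: "(\<Sum>i\<in>J. c i * red v i ^ p) = 0" if v: "v \<in> V" for v
      proof -
        have "(\<Sum>i\<in>I. c i * red v i ^ p)
          = (\<Sum>i\<in>I. c i * v i ^ p) - (v i0 / w i0) ^ p * (\<Sum>i\<in>I. c i * w i ^ p)"
          by (simp add: red_def frob_diff power_mult_distrib sum_distrib_left right_diff_distrib
              sum_subtractf power_divide mult_ac)
        also have "\<dots> = 0" using Suc.prems(5) v w(1) by simp
        finally show ?thesis using J red0 p0 by (simp add: power_0_left)
      qed
      have "\<exists>i\<in>J. c i \<noteq> 0"
      proof (rule ccontr)
        assume "\<not> ?thesis"
        then have "(\<Sum>i\<in>J. c i * w i ^ p) = 0" and "c i0 \<noteq> 0" using Suc.prems(4) J by auto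
        moreover have "(\<Sum>i\<in>I. c i * w i ^ p) = 0" using Suc.prems(5) w(1) by blast
        ultimately show False using J w(3) by simp
      qed
      moreover have "red v i \<in> K" if "v \<in> V" "i \<in> J" for v i
        using that w Suc.prems(2) J R(5,6) field_closedD(3)[OF K] by (auto simp: red_def)
      ultimately obtain c' where c': "\<forall>i\<in>J. c' i \<in> K" "\<exists>i\<in>J. c' i \<noteq> 0"
        "\<forall>v\<in>V. (\<Sum>i\<in>J. c' i * red v i) = 0"
        using Suc.hyps(1)[of J "red ` V" c] Suc.prems J red_sum by auto
      \<comment> \<open>The entry at \<open>i0\<close> is chosen so that the relation holds for the column \<open>w\<close>, hence for
        every column \<open>v = red v + (v i0 / w i0) * w\<close>.\<close>
      define e where "e = - (\<Sum>i\<in>J. c' i * w i) / w i0"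
      have "e \<in> K"
        unfolding e_def using w J c'(1) Suc.prems(2)
        by (intro field_closedD(3)[OF K] R(3,8,5)) auto
      moreover have "e * v i0 + (\<Sum>i\<in>J. c' i * v i) = 0" if v: "v \<in> V" for v
      proof -
        have "(\<Sum>i\<in>J. c' i * red v i)
          = (\<Sum>i\<in>J. c' i * v i) - (v i0 / w i0) * (\<Sum>i\<in>J. c' i * w i)"
          by (simp add: red_def right_diff_distrib sum_subtractf sum_distrib_left mult_ac)
        then show ?thesis using c'(3) v w(3) by (simp add: e_def field_simps)
      qed
      moreover have "(\<Sum>i\<in>J. (c'(i0 := e)) i * v i) = (\<Sum>i\<in>J. c' i * v i)" for v
        using J(4) by (intro sum.cong) auto
      moreover have "\<exists>i\<in>I. (c'(i0 := e)) i \<noteq> 0"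
        using c'(2) J(3,4) by (metis fun_upd_apply insertCI)
      ultimately show ?thesis
        using c'(1) J by (intro exI[of _ "c'(i0 := e)"]) (simp add: fun_upd_def)
    qed
  qed
  then show ?thesis unfolding frobenius_descent_def by blast
qed

text \<open>
  After clearing denominators in each column, the relation is one between \<open>p\<close>-th powers of polynomials
  evaluated at \<open>t\<close>.  Now \<open>(\<Sum>l. a\<^sub>l t^l)^p = \<Sum>l. a\<^sub>l^p t^(pl)\<close>, so transcendence of \<open>t\<close> splits the
  relation into relations between \<open>p\<close>-th powers of the coefficients, one for each \<open>l\<close>.
\<close>

lemma frobenius_descent_adjoin:
  assumes K: "field_closed K" and F: "field_closed F" and KF: "K \<subseteq> F"
    and p: "p = CHAR('a::Fields.field)" "Factorial_Ring.prime p"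
    and desc: "frobenius_descent p K (F :: 'a set)" and t: "transcendental_over F t"
  shows "frobenius_descent p K (adjoin F t)"
  unfolding frobenius_descent_def
proof (intro allI impI, elim conjE)
  fix I :: "nat set" and V :: "(nat \<Rightarrow> 'a) set" and c
  assume I: "finite I" and V: "\<forall>v\<in>V. \<forall>i\<in>I. v i \<in> adjoin F t" and c: "\<forall>i\<in>I. c i \<in> K"
    and nz: "\<exists>i\<in>I. c i \<noteq> 0" and rel: "\<forall>v\<in>V. (\<Sum>i\<in>I. c i * v i ^ p) = 0"
  note RF = ring_closedD[OF field_closedD(1)[OF F]]
  have p0: "p > 0" using p(2) prime_gt_0_nat by blast
  have "\<exists>b f. b \<noteq> 0 \<and> (\<forall>i\<in>I. f i \<in> polys_over F \<and> b * v i = poly (f i) t)" if "v \<in> V" for v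
  proof -
    have "v ` I \<subseteq> fractions ((\<lambda>p. poly p t) ` polys_over F)"
      using V that by (auto simp: adjoin_def)
    then obtain b where "b \<noteq> 0" "\<And>x. x \<in> v ` I \<Longrightarrow> b * x \<in> (\<lambda>p. poly p t) ` polys_over F"
      using common_denominator[OF ring_closed_poly_values[OF field_closedD(1)[OF F]]] I
      by (metis finite_imageI)
    then have "\<forall>i\<in>I. \<exists>g. g \<in> polys_over F \<and> b * v i = poly g t" by auto
    then show ?thesis using \<open>b \<noteq> 0\<close> by (meson bchoice)
  qed
  then obtain b f where b: "\<And>v. v \<in> V \<Longrightarrow> b v \<noteq> 0"
    and f: "\<And>v i. v \<in> V \<Longrightarrow> i \<in> I \<Longrightarrow> f v i \<in> polys_over F"
    and bf: "\<And>v i. v \<in> V \<Longrightarrow> i \<in> I \<Longrightarrow> b v * v i = poly (f v i) t"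
    by metis
  define W where "W = {\<lambda>i. Polynomial.coeff (f v i) k | v k. v \<in> V}"
  have "(\<Sum>i\<in>I. c i * Polynomial.coeff (f v i) k ^ p) = 0" if v: "v \<in> V" for v k
  proof -
    define N where "N = Max (insert k ((\<lambda>i. Polynomial.degree (f v i)) ` I))"
    have N: "Polynomial.degree (f v i) \<le> N" if "i \<in> I" for i
      using I that by (auto simp: N_def)
    have kN: "k \<le> N" using I by (auto simp: N_def)
    define g where "g l = (\<Sum>i\<in>I. c i * Polynomial.coeff (f v i) l ^ p)" for l
    \<comment> \<open>Its value at \<open>t\<close> is the relation between the \<open>p\<close>-th powers of the polynomials \<open>f v i\<close>.\<close>
    define G where "G = (\<Sum>l\<le>N. Polynomial.monom (g l) (p * l))"
    have g: "g l \<in> F" for l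
      unfolding g_def using f[OF v] c KF by (intro RF(8,5,7)) (auto simp: polys_over_def)
    have coeff_G: "Polynomial.coeff G j = (\<Sum>l\<le>N. if p * l = j then g l else 0)" for j
      by (simp add: G_def coeff_sum)
    have "poly G t = (\<Sum>l\<le>N. \<Sum>i\<in>I. c i * (Polynomial.coeff (f v i) l * t ^ l) ^ p)"
      by (simp add: G_def poly_sum poly_monom g_def sum_distrib_left sum_distrib_right
          power_mult_distrib power_mult[symmetric] mult_ac)
    also have "\<dots> = (\<Sum>i\<in>I. c i * (\<Sum>l\<le>N. (Polynomial.coeff (f v i) l * t ^ l) ^ p))"
      by (subst sum.swap) (simp add: sum_distrib_left)
    also have "\<dots> = (\<Sum>i\<in>I. c i * (\<Sum>l\<le>N. Polynomial.coeff (f v i) l * t ^ l) ^ p)"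
      by (subst freshmans_dream_sum) (use p in auto)
    also have "\<dots> = (\<Sum>i\<in>I. c i * poly (f v i) t ^ p)"
    proof (intro sum.cong refl)
      fix i assume "i \<in> I"
      have "poly (f v i) t = (\<Sum>l\<le>N. Polynomial.coeff (f v i) l * t ^ l)"
        unfolding poly_altdef using N[OF \<open>i \<in> I\<close>]
        by (intro sum.mono_neutral_left) (auto simp: coeff_eq_0)
      then show "c i * (\<Sum>l\<le>N. Polynomial.coeff (f v i) l * t ^ l) ^ p = c i * poly (f v i) t ^ p"
        by simp
    qed
    also have "\<dots> = b v ^ p * (\<Sum>i\<in>I. c i * v i ^ p)"
      using bf[OF v, symmetric] by (simp add: power_mult_distrib sum_distrib_left mult_ac)
    also have "\<dots> = 0" using rel v by simp
    finally have "poly G t = 0" .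
    moreover have "G \<in> polys_over F"
      using g RF(2) by (auto simp: polys_over_def coeff_G intro!: RF(8))
    ultimately have "G = 0" using t by (auto simp: transcendental_over_def)
    then have "(\<Sum>l\<le>N. if p * l = p * k then g l else 0) = 0" using coeff_G by (metis coeff_0)
    moreover have "(\<Sum>l\<le>N. if p * l = p * k then g l else 0) = g k"
      using p0 kN by (simp add: sum.delta)
    ultimately show ?thesis by (simp add: g_def)
  qed
  then have "\<forall>w\<in>W. (\<Sum>i\<in>I. c i * w i ^ p) = 0" by (auto simp: W_def)
  moreover have "\<forall>w\<in>W. \<forall>i\<in>I. w i \<in> F" using f by (auto simp: W_def polys_over_def)
  ultimately have "\<exists>c'. (\<forall>i\<in>I. c' i \<in> K) \<and> (\<exists>i\<in>I. c' i \<noteq> 0) \<and> (\<forall>w\<in>W. (\<Sum>i\<in>I. c' i * w i) = 0)"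
    using I c nz
    by (intro desc[unfolded frobenius_descent_def, THEN spec, THEN spec, THEN spec, THEN mp, of I W c] conjI)
  then obtain c' where c': "\<forall>i\<in>I. c' i \<in> K" "\<exists>i\<in>I. c' i \<noteq> 0"
    "\<And>w. w \<in> W \<Longrightarrow> (\<Sum>i\<in>I. c' i * w i) = 0" by blast
  have "(\<Sum>i\<in>I. c' i * v i) = 0" if v: "v \<in> V" for v
  proof -
    \<comment> \<open>The relations between the coefficients reassemble to one between the polynomials.\<close>
    have "(\<Sum>i\<in>I. Polynomial.smult (c' i) (f v i)) = 0"
      using c'(3) v by (intro poly_eqI) (auto simp: coeff_sum W_def)
    then have "(\<Sum>i\<in>I. c' i * poly (f v i) t) = 0" by (metis (no_types, lifting) poly_0 poly_smult poly_sum sum.cong)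
    then have "b v * (\<Sum>i\<in>I. c' i * v i) = 0"
      using bf[OF v, symmetric] by (simp add: sum_distrib_left mult_ac)
    then show ?thesis using b[OF v] by simp
  qed
  then show "\<exists>c'. (\<forall>i\<in>I. c' i \<in> K) \<and> (\<exists>i\<in>I. c' i \<noteq> 0) \<and> (\<forall>v\<in>V. (\<Sum>i\<in>I. c' i * v i) = 0)"
    using c' by blast
qed

lemma frobenius_descent_tower:
  assumes K: "field_closed K" and p: "p = CHAR('a::Fields.field)" "Factorial_Ring.prime p"
    and "\<And>k. k < m \<Longrightarrow> transcendental_over (tower K y k) (y k :: 'a)"
  shows "frobenius_descent p K (tower K y m)"
  using assms(4)
proof (induction m)
  case (Suc m)
  then show ?case
    using frobenius_descent_adjoin[OF K field_closed_tower[OF K] base_subset_tower[OF K] p] by simp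
qed (simp add: frobenius_descent_base[OF K p])

lemma combine_universe_ring:
  assumes "field_closed T" "length Ks = length xs"
  shows "ring.combine (universe_ring T) Ks xs = (\<Sum>i<length xs. Ks ! i * xs ! i)"
proof -
  interpret R: field "universe_ring T" by (rule field_universe_ring[OF assms(1)])
  show ?thesis using assms(2)
    by (induction Ks xs rule: list_induct2) (simp_all add: sum.lessThan_Suc_shift del: sum.lessThan_Suc)
qed

text \<open>
  Regarded as a single column, a list whose \<open>p\<close>-th powers are linearly dependent over \<open>K\<close> is itself
  linearly dependent, by the descent property of the tower.
\<close>

lemma separable_over_tower:
  fixes K :: "'a::Fields.field set"
  assumes K: "field_closed K"
    and y: "\<And>k. k < m \<Longrightarrow> transcendental_over (tower K y k) (y k)"
  shows "separable_over (universe_ring (tower K y m)) K"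
  unfolding separable_over_def
proof (intro allI impI, elim conjE)
  let ?T = "tower K y m"
  note T = field_closed_tower[OF K, of y m]
  interpret R: field "universe_ring ?T" by (rule field_universe_ring[OF T])
  note RT = ring_closedD[OF field_closedD(1)[OF T]]
  have sub: "subfield K (universe_ring ?T)"
    using subfield_universe_ring_iff[OF T] K base_subset_tower[OF K] by blast
  fix p :: nat and xs
  assume prime: "Factorial_Ring.prime p"
    and "[p] \<cdot>\<^bsub>universe_ring ?T\<^esub> \<one>\<^bsub>universe_ring ?T\<^esub> = \<zero>\<^bsub>universe_ring ?T\<^esub>"
    and "set xs \<subseteq> carrier (universe_ring ?T)" and ind: "ring.independent (universe_ring ?T) K xs"
  then have xs: "set xs \<subseteq> ?T" by simp
  have "[k] \<cdot>\<^bsub>universe_ring ?T\<^esub> \<one>\<^bsub>universe_ring ?T\<^esub> = of_nat k" for k :: nat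
    by (induction k) (simp_all add: add.commute)
  then have "of_nat p = (0::'a)"
    using \<open>[p] \<cdot>\<^bsub>universe_ring ?T\<^esub> \<one>\<^bsub>universe_ring ?T\<^esub> = \<zero>\<^bsub>universe_ring ?T\<^esub>\<close> by simp
  then have p: "p = CHAR('a)"
    using prime by (metis CHAR_not_1' One_nat_def of_nat_eq_0_iff_char_dvd prime_nat_iff)
  have pow: "x [^]\<^bsub>universe_ring ?T\<^esub> k = x ^ k" for x and k :: nat
    by (induction k) (simp_all add: mult.commute)
  show "ring.independent (universe_ring ?T) K (map (\<lambda>x. x [^]\<^bsub>universe_ring ?T\<^esub> p) xs)"
  proof (rule ccontr)
    assume dep: "\<not> ?thesis"
    have pow_closed: "(\<lambda>x. x ^ p) ` set xs \<subseteq> ?T" using xs RT(7) by auto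
    obtain Ks where "length Ks = length (map (\<lambda>x. x ^ p) xs)"
      "ring.combine (universe_ring ?T) Ks (map (\<lambda>x. x ^ p) xs) = 0"
      "set Ks \<subseteq> K" "set Ks \<noteq> {0}"
      by (rule R.dependent_imp_non_trivial_combine[OF sub _ dep[unfolded pow]])
        (use pow_closed in auto)
    then have Ks: "length Ks = length xs" "set Ks \<subseteq> K" "set Ks \<noteq> {0}"
      "ring.combine (universe_ring ?T) Ks (map (\<lambda>x. x ^ p) xs) = 0" by auto
    have "xs \<noteq> []" using dep R.li_Nil by auto
    then have "\<exists>k \<in> set Ks. k \<noteq> 0" using Ks(1,3) by (cases Ks) auto
    then have "\<exists>i \<in> {..<length xs}. Ks ! i \<noteq> 0" using Ks(1) by (metis in_set_conv_nth lessThan_iff)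
    moreover have "(\<Sum>i<length xs. Ks ! i * (xs ! i) ^ p) = 0"
      using Ks(4) combine_universe_ring[OF T, of Ks "map (\<lambda>x. x ^ p) xs"] Ks(1) by simp
    ultimately obtain c where c: "\<forall>i<length xs. c i \<in> K" "\<exists>i<length xs. c i \<noteq> 0"
      "(\<Sum>i<length xs. c i * xs ! i) = 0"
      using frobenius_descent_tower[OF K p prime y, unfolded frobenius_descent_def,
          rule_format, of m "{..<length xs}" "{\<lambda>i. xs ! i}" "\<lambda>i. Ks ! i"] Ks(1,2) xs
      by (auto simp: subset_iff)
    let ?Cs = "map c [0..<length xs]"
    have "ring.combine (universe_ring ?T) ?Cs xs = 0"
      using combine_universe_ring[OF T, of ?Cs xs] c(3) by simp
    moreover have "set ?Cs \<subseteq> K" using c(1) by auto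
    ultimately have "set ?Cs \<subseteq> {0}"
      using R.independent_imp_trivial_combine[OF sub ind, of ?Cs] by simp
    then show False using c(2) by (auto simp: image_subset_iff)
  qed
qed

section \<open>Algebraic independence of the derivatives of an indeterminate\<close>

definition monomial_value :: "('a::comm_semiring_1 \<Rightarrow> 'a) \<Rightarrow> (nat \<Rightarrow> 'a) \<Rightarrow> (nat \<times> nat \<Rightarrow>\<^sub>0 nat) \<Rightarrow> 'a"
  where "monomial_value d x m =
    (\<Prod>(i, k) \<in> Poly_Mapping.keys m. ((d ^^ k) (x i)) ^ Poly_Mapping.lookup m (i, k))"

lemma monomial_value_superset:
  assumes "finite A" "Poly_Mapping.keys m \<subseteq> A"
  shows "monomial_value d x m = (\<Prod>(i, k) \<in> A. ((d ^^ k) (x i)) ^ Poly_Mapping.lookup m (i, k))"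
  unfolding monomial_value_def using assms
  by (intro prod.mono_neutral_left) (auto simp: in_keys_iff)

lemma monomial_value_add:
  "monomial_value d x (m + m') = monomial_value d x m * monomial_value d x m'"
proof -
  let ?A = "Poly_Mapping.keys m \<union> Poly_Mapping.keys m'"
  have "Poly_Mapping.keys (m + m') \<subseteq> ?A" by (rule Poly_Mapping.keys_add)
  then show ?thesis
    by (simp add: monomial_value_superset[of ?A] lookup_add power_add case_prod_unfold
        flip: prod.distrib)
qed

lemma monomial_value_single:
  "monomial_value d x (Poly_Mapping.single (i, k) e) = ((d ^^ k) (x i)) ^ e"
  by (subst monomial_value_superset[of "{(i, k)}"]) auto

lemma monomial_value_zero: "monomial_value d x 0 = 1"
  by (simp add: monomial_value_def)

lemma dpoly_eval_superset:
  assumes "finite A" "Poly_Mapping.keys f \<subseteq> A"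
  shows "dpoly_eval d f x = (\<Sum>m\<in>A. Poly_Mapping.lookup f m * monomial_value d x m)"
  unfolding dpoly_eval_def monomial_value_def[symmetric] using assms
  by (intro sum.mono_neutral_left) (auto simp: in_keys_iff)

lemma dpoly_eval_zero: "dpoly_eval d 0 x = 0"
  by (simp add: dpoly_eval_def)

lemma dpoly_eval_add: "dpoly_eval d (f + g) x = dpoly_eval d f x + dpoly_eval d g x"
proof -
  let ?A = "Poly_Mapping.keys f \<union> Poly_Mapping.keys g"
  have "Poly_Mapping.keys (f + g) \<subseteq> ?A" by (rule Poly_Mapping.keys_add)
  then show ?thesis
    by (simp add: dpoly_eval_superset[of ?A] lookup_add distrib_right sum.distrib)
qed

lemma dpoly_eval_sum: "dpoly_eval d (sum f A) x = (\<Sum>i\<in>A. dpoly_eval d (f i) x)"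
  by (induction A rule: infinite_finite_induct) (auto simp: dpoly_eval_zero dpoly_eval_add)

lemma dpoly_eval_diff:
  fixes f g :: "'a::comm_ring_1 dpoly"
  shows "dpoly_eval d (f - g) x = dpoly_eval d f x - dpoly_eval d g x"
  using dpoly_eval_add[of d "f - g" g x] by simp

lemma dpoly_eval_single:
  "dpoly_eval d (Poly_Mapping.single m c) x = c * monomial_value d x m"
  by (subst dpoly_eval_superset[of "{m}"]) auto

definition dpolys_in_variables :: "'a::zero set \<Rightarrow> (nat \<times> nat) set \<Rightarrow> 'a dpoly set" where
  "dpolys_in_variables K V = {f. (\<forall>m. Poly_Mapping.lookup f m \<in> K) \<and>
     (\<forall>m \<in> Poly_Mapping.keys f. Poly_Mapping.keys m \<subseteq> V)}"

lemma dpolys_in_variables_add: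
  assumes "ring_closed K" "f \<in> dpolys_in_variables K V" "g \<in> dpolys_in_variables K V"
  shows "f + g \<in> dpolys_in_variables K V"
  using assms(2,3) ring_closedD(4)[OF assms(1)] Poly_Mapping.keys_add[of f g]
  by (fastforce simp: dpolys_in_variables_def lookup_add)

lemma dpolys_in_variables_sum:
  assumes "ring_closed K" "\<And>i. i \<in> A \<Longrightarrow> f i \<in> dpolys_in_variables K V"
  shows "sum f A \<in> dpolys_in_variables K V"
  using assms(2)
proof (induction A rule: infinite_finite_induct)
  case (insert i A)
  then show ?case using dpolys_in_variables_add[OF assms(1)] by simp
qed (use ring_closedD(2)[OF assms(1)] in \<open>auto simp: dpolys_in_variables_def\<close>)

lemma dpolys_in_variables_single:
  assumes "ring_closed K" "c \<in> K" "Poly_Mapping.keys m \<subseteq> V"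
  shows "Poly_Mapping.single m c \<in> dpolys_in_variables K V"
  using assms ring_closedD(2)[OF assms(1)]
  by (auto simp: dpolys_in_variables_def lookup_single when_def split: if_splits)

text \<open>
  The product of two values is expanded into monomials, so that multiplicativity of evaluation is
  needed for monomials only.
\<close>

lemma ring_closed_dpoly_values:
  assumes K: "ring_closed K"
  shows "ring_closed ((\<lambda>f. dpoly_eval d f x) ` dpolys_in_variables K V)" (is "ring_closed ?R")
proof -
  note RK = ring_closedD[OF K]
  have monomial_in: "c * monomial_value d x m \<in> ?R" if "c \<in> K" "Poly_Mapping.keys m \<subseteq> V" for c m
    using dpolys_in_variables_single[OF K that] by (auto simp: dpoly_eval_single image_iff intro!: bexI)
  have add: "a + b \<in> ?R" if "a \<in> ?R" "b \<in> ?R" for a b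
    using that dpolys_in_variables_add[OF K] by (auto simp flip: dpoly_eval_add)
  have zero: "0 \<in> ?R" using monomial_in[of 0 0] RK(2) by simp
  have sum: "sum h A \<in> ?R" if "\<And>i. i \<in> A \<Longrightarrow> h i \<in> ?R" for h :: "(nat \<times> nat \<Rightarrow>\<^sub>0 nat) \<Rightarrow> 'a" and A
    using that
  proof (induction A rule: infinite_finite_induct)
    case (insert i A)
    then show ?case using add[of "h i" "sum h A"] by simp
  qed (simp_all add: zero)
  have mult: "a * b \<in> ?R" if a: "a \<in> ?R" and b: "b \<in> ?R" for a b
  proof -
    obtain f where f: "f \<in> dpolys_in_variables K V" "a = dpoly_eval d f x" using a by blast
    obtain g where g: "g \<in> dpolys_in_variables K V" "b = dpoly_eval d g x" using b by blast
    have "a * b = (\<Sum>m\<in>Poly_Mapping.keys f. \<Sum>m'\<in>Poly_Mapping.keys g.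
      (Poly_Mapping.lookup f m * Poly_Mapping.lookup g m') * monomial_value d x (m + m'))"
      unfolding f(2) g(2)
        dpoly_eval_superset[OF finite_keys order_refl] sum_product monomial_value_add
      by (simp add: mult_ac)
    also have "\<dots> \<in> ?R"
    proof (intro sum monomial_in)
      fix m m' assume "m \<in> Poly_Mapping.keys f" "m' \<in> Poly_Mapping.keys g"
      then show "Poly_Mapping.keys (m + m') \<subseteq> V"
        using f(1) g(1) Poly_Mapping.keys_add[of m m']
        unfolding dpolys_in_variables_def by blast
    qed (use f(1) g(1) RK(5) in \<open>auto simp: dpolys_in_variables_def\<close>)
    finally show ?thesis .
  qed
  have one: "1 \<in> ?R" using monomial_in[of 1 0] RK(1) by (simp add: monomial_value_zero)
  have neg_one: "-1 \<in> ?R" using monomial_in[of "-1" 0] RK(1,3) by (simp add: monomial_value_zero)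
  have "- a \<in> ?R" if "a \<in> ?R" for a using mult[OF neg_one that] by simp
  then show ?thesis using one add mult unfolding ring_closed_def by blast
qed

text \<open>
  Suppose \<open>p\<close> has the new derivative as a root.  After clearing denominators, its coefficients are
  values of differential polynomials \<open>f\<^sub>l\<close> in the variables \<open>V\<close>, and \<open>\<Sum>l. f\<^sub>l X^l\<close> is a differential
  polynomial, \<open>X\<close> being the variable \<open>(i, k)\<close>, whose value is zero.  It is therefore zero, and as \<open>X\<close>
  does not occur in the \<open>f\<^sub>l\<close>, each of them is zero.
\<close>

lemma new_variable_transcendental:
  assumes K: "ring_closed K" and "finite V" and v: "(i, k) \<notin> V"
    and indep: "\<And>f. f \<in> dpolys_in_variables K (insert (i, k) V) \<Longrightarrow> dpoly_eval d f x = 0 \<Longrightarrow> f = 0"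
  shows "transcendental_over (fractions ((\<lambda>f. dpoly_eval d f x) ` dpolys_in_variables K V))
    ((d ^^ k) (x i))"
  unfolding transcendental_over_def
proof (intro ballI impI)
  let ?R = "(\<lambda>f. dpoly_eval d f x) ` dpolys_in_variables K V"
  let ?y = "(d ^^ k) (x i)"
  fix p assume p: "p \<in> polys_over (fractions ?R)" and root: "poly p ?y = 0"
  have "Polynomial.coeff p ` {..Polynomial.degree p} \<subseteq> fractions ?R"
    using p by (auto simp: polys_over_def)
  then obtain b where b: "b \<in> ?R" "b \<noteq> 0"
    "\<And>z. z \<in> Polynomial.coeff p ` {..Polynomial.degree p} \<Longrightarrow> b * z \<in> ?R"
    by (rule common_denominator[OF ring_closed_dpoly_values[OF K], rotated]) simp_all
  have "\<forall>l \<in> {..Polynomial.degree p}. \<exists>f. f \<in> dpolys_in_variables K V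
      \<and> dpoly_eval d f x = b * Polynomial.coeff p l"
  proof
    fix l assume "l \<in> {..Polynomial.degree p}"
    then have "b * Polynomial.coeff p l \<in> ?R" by (intro b(3) imageI)
    then show "\<exists>f. f \<in> dpolys_in_variables K V \<and> dpoly_eval d f x = b * Polynomial.coeff p l"
      by force
  qed
  from bchoice[OF this] obtain f where f: "\<And>l. l \<le> Polynomial.degree p \<Longrightarrow> f l \<in> dpolys_in_variables K V"
    "\<And>l. l \<le> Polynomial.degree p \<Longrightarrow> dpoly_eval d (f l) x = b * Polynomial.coeff p l"
    by auto
  let ?v = "\<lambda>l. Poly_Mapping.single (i, k) l"
  define g where "g = (\<Sum>l\<le>Polynomial.degree p. \<Sum>m\<in>Poly_Mapping.keys (f l).
    Poly_Mapping.single (m + ?v l) (Poly_Mapping.lookup (f l) m))"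
  have "g \<in> dpolys_in_variables K (insert (i, k) V)"
    unfolding g_def
  proof (intro dpolys_in_variables_sum[OF K] dpolys_in_variables_single[OF K])
    fix l m assume lm: "l \<in> {..Polynomial.degree p}" "m \<in> Poly_Mapping.keys (f l)"
    show "Poly_Mapping.lookup (f l) m \<in> K" using f(1)[of l] lm by (auto simp: dpolys_in_variables_def)
    have "Poly_Mapping.keys m \<subseteq> V" using f(1)[of l] lm by (auto simp: dpolys_in_variables_def)
    then show "Poly_Mapping.keys (m + ?v l) \<subseteq> insert (i, k) V"
      using Poly_Mapping.keys_add[of m "?v l"] by (auto split: if_splits)
  qed
  moreover have "dpoly_eval d g x = 0"
  proof -
    have "dpoly_eval d g x = (\<Sum>l\<le>Polynomial.degree p. dpoly_eval d (f l) x * ?y ^ l)"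
      by (simp add: g_def dpoly_eval_sum dpoly_eval_single monomial_value_add monomial_value_single
          dpoly_eval_superset[OF finite_keys order_refl, of d "f _"] sum_distrib_left sum_distrib_right mult_ac)
    also have "\<dots> = b * poly p ?y"
      by (simp add: f(2) poly_altdef sum_distrib_left mult_ac)
    finally show ?thesis using root by simp
  qed
  ultimately have g0: "g = 0" by (rule indep)
  have "f l0 = 0" if l0: "l0 \<le> Polynomial.degree p" for l0
  proof (rule poly_mapping_eqI)
    fix m0
    have no_v: "Poly_Mapping.lookup m (i, k) = 0"
      if "m \<in> Poly_Mapping.keys (f l)" "l \<le> Polynomial.degree p" for m l
    proof -
      have "Poly_Mapping.keys m \<subseteq> V"
        using f(1)[OF that(2)] that(1) by (simp add: dpolys_in_variables_def)
      then show ?thesis using v by (auto simp flip: not_in_keys_iff_lookup_eq_zero)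
    qed
    show "Poly_Mapping.lookup (f l0) m0 = Poly_Mapping.lookup 0 m0"
    proof (cases "m0 \<in> Poly_Mapping.keys (f l0)")
      case True
      \<comment> \<open>The exponent of \<open>(i, k)\<close> recovers \<open>l\<close>, so distinct terms of \<open>g\<close> cannot cancel.\<close>
      have eq_iff: "m + ?v l = m0 + ?v l0 \<longleftrightarrow> m = m0 \<and> l = l0"
        if "m \<in> Poly_Mapping.keys (f l)" "l \<le> Polynomial.degree p" for m l
      proof
        assume eq: "m + ?v l = m0 + ?v l0"
        have "Poly_Mapping.lookup (m + ?v l) (i, k) = l"
          "Poly_Mapping.lookup (m0 + ?v l0) (i, k) = l0"
          using no_v[OF that] no_v[OF True l0] by (simp_all add: lookup_add)
        then show "m = m0 \<and> l = l0" using eq by auto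
      qed auto
      have "0 = Poly_Mapping.lookup g (m0 + ?v l0)" by (simp add: g0)
      also have "\<dots> = (\<Sum>l\<le>Polynomial.degree p. \<Sum>m\<in>Poly_Mapping.keys (f l).
          if m = m0 \<and> l = l0 then Poly_Mapping.lookup (f l) m else 0)"
        unfolding g_def lookup_sum
        by (intro sum.cong refl) (auto simp: lookup_single when_def eq_iff)
      also have "\<dots> = (\<Sum>l\<le>Polynomial.degree p. if l = l0 then Poly_Mapping.lookup (f l0) m0 else 0)"
        using True by (intro sum.cong refl) (auto simp: sum.delta)
      also have "\<dots> = Poly_Mapping.lookup (f l0) m0" using l0 by simp
      finally show ?thesis by simp
    qed (simp add: in_keys_iff)
  qed
  then have "Polynomial.coeff p l = 0" if "l \<le> Polynomial.degree p" for l
    using f(2)[OF that] that b(2) by (simp add: dpoly_eval_zero)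
  then show "p = 0" by (metis leading_coeff_0_iff order_refl)
qed

text \<open>
  The tower generated by the lower derivatives lies in the fraction field of the ring of values of
  the differential polynomials in these derivatives.
\<close>

lemma derivatives_transcendental:
  assumes K: "field_closed K" and u: "diff_indeterminates d K I u" and i: "i \<in> I"
  shows "transcendental_over (tower K (\<lambda>k. (d ^^ k) (u i)) m) ((d ^^ m) (u i))"
proof -
  note RK = field_closedD(1)[OF K]
  let ?V = "{i} \<times> {..<m}"
  let ?R = "(\<lambda>f. dpoly_eval d f u) ` dpolys_in_variables K ?V"
  have R: "ring_closed ?R" by (rule ring_closed_dpoly_values[OF RK])
  have value_in: "c * monomial_value d u s \<in> ?R" if "c \<in> K" "Poly_Mapping.keys s \<subseteq> ?V" for c s
    using dpolys_in_variables_single[OF RK that] by (metis dpoly_eval_single imageI)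
  have "tower K (\<lambda>k. (d ^^ k) (u i)) m \<subseteq> fractions ?R"
  proof (rule tower_subset[OF field_closed_fractions[OF R]])
    show "K \<subseteq> fractions ?R"
      using value_in[of _ 0] subset_fractions[OF R] by (auto simp: monomial_value_zero)
    fix k assume "k < m"
    then show "(d ^^ k) (u i) \<in> fractions ?R"
      using value_in[of 1 "Poly_Mapping.single (i, k) 1"] ring_closedD(1)[OF RK] subset_fractions[OF R]
      by (auto simp: monomial_value_single)
  qed
  moreover have "transcendental_over (fractions ?R) ((d ^^ m) (u i))"
  proof (rule new_variable_transcendental[OF RK])
    fix f assume "f \<in> dpolys_in_variables K (insert (i, m) ?V)" "dpoly_eval d f u = 0"
    moreover from this have "f \<in> dpolys K I"
      using i by (fastforce simp: dpolys_in_variables_def dpolys_def)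
    ultimately show "f = 0" using u by (auto simp: diff_indeterminates_def)
  qed auto
  ultimately show ?thesis by (auto simp: transcendental_over_def polys_over_def)
qed

section \<open>Linear differential operators and their solutions\<close>

definition op_apply :: "('a::comm_ring_1 \<Rightarrow> 'a) \<Rightarrow> 'a poly \<Rightarrow> 'a \<Rightarrow> 'a" where
  "op_apply d Q v = (\<Sum>k\<le>Polynomial.degree Q. Polynomial.coeff Q k * (d ^^ k) v)"

lemma op_apply_bound:
  "Polynomial.degree Q \<le> N \<Longrightarrow> op_apply d Q v = (\<Sum>k\<le>N. Polynomial.coeff Q k * (d ^^ k) v)"
  unfolding op_apply_def by (intro sum.mono_neutral_left) (auto simp: coeff_eq_0)

lemma op_apply_add: "op_apply d (P + Q) v = op_apply d P v + op_apply d Q v"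
proof -
  let ?N = "max (Polynomial.degree P) (Polynomial.degree Q)"
  have "Polynomial.degree (P + Q) \<le> ?N" by (rule degree_add_le) auto
  then show ?thesis by (simp add: op_apply_bound[of _ ?N] distrib_right sum.distrib)
qed

lemma op_apply_smult: "op_apply d (Polynomial.smult c Q) v = c * op_apply d Q v"
  using degree_smult_le[of c Q]
  by (simp add: op_apply_bound[of _ "Polynomial.degree Q"] sum_distrib_left mult.assoc)

lemma op_apply_sum: "op_apply d (sum f A) v = (\<Sum>i\<in>A. op_apply d (f i) v)"
proof (induction A rule: infinite_finite_induct)
  case (insert i A)
  then show ?case by (simp add: op_apply_add)
qed (simp_all add: op_apply_def)

lemma derivation_on_funpow_add:
  "derivation_on UNIV d \<Longrightarrow> (d ^^ k) (v + w) = (d ^^ k) v + (d ^^ k) w"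
  by (induction k) (auto simp: derivation_on_def)

lemma derivation_on_funpow_zero:
  "derivation_on UNIV d \<Longrightarrow> (d ^^ k) 0 = 0"
  using derivation_on_funpow_add[of d k 0 0] by (metis add.right_neutral add_left_imp_eq)

lemma op_apply_argument_add:
  "derivation_on UNIV d \<Longrightarrow> op_apply d Q (v + w) = op_apply d Q v + op_apply d Q w"
  by (simp add: op_apply_def derivation_on_funpow_add distrib_left sum.distrib)

lemma op_apply_argument_zero: "derivation_on UNIV d \<Longrightarrow> op_apply d Q 0 = 0"
  by (simp add: op_apply_def derivation_on_funpow_zero)

lemma op_apply_del_mult:
  assumes d: "derivation_on UNIV d"
  shows "op_apply d (del_mult d Q) v = d (op_apply d Q v)"
proof -
  have U: "ring_closed (UNIV :: 'a set)" by (simp add: ring_closed_def)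
  note D = derivation_on_simps[OF U d]
  let ?N = "Polynomial.degree Q"
  have "op_apply d (pCons 0 Q) v = (\<Sum>k\<le>Suc ?N. Polynomial.coeff (pCons 0 Q) k * (d ^^ k) v)"
    by (rule op_apply_bound) (rule degree_pCons_le)
  also have "\<dots> = (\<Sum>k\<le>?N. Polynomial.coeff Q k * d ((d ^^ k) v))"
    by (subst sum.atMost_Suc_shift) simp
  finally have shift: "op_apply d (pCons 0 Q) v = (\<Sum>k\<le>?N. Polynomial.coeff Q k * d ((d ^^ k) v))" .
  have coeffs: "op_apply d (map_poly d Q) v = (\<Sum>k\<le>?N. d (Polynomial.coeff Q k) * (d ^^ k) v)"
    by (subst op_apply_bound[OF map_poly_degree_leq]) (simp add: coeff_map_poly D(1))
  have "d (op_apply d Q v) = (\<Sum>k\<le>?N. d (Polynomial.coeff Q k * (d ^^ k) v))"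
    unfolding op_apply_def by (rule D(4)) simp
  also have "\<dots> = (\<Sum>k\<le>?N. d (Polynomial.coeff Q k) * (d ^^ k) v + Polynomial.coeff Q k * d ((d ^^ k) v))"
    using d by (simp add: derivation_on_def)
  finally show ?thesis
    by (simp add: del_mult_def op_apply_add shift coeffs sum.distrib add.commute)
qed

text \<open>
  The skew product is the composition of operators: multiplication by \<open>\<partial>\<close> on the left
  corresponds to applying \<open>d\<close>.
\<close>

lemma op_apply_op_mult:
  assumes d: "derivation_on UNIV d"
  shows "op_apply d (op_mult d P Q) v = op_apply d P (op_apply d Q v)"
proof -
  have "op_apply d ((del_mult d ^^ k) Q) v = (d ^^ k) (op_apply d Q v)" for k
    by (induction k) (simp_all add: op_apply_del_mult[OF d])
  then show ?thesis
    by (simp add: op_mult_def op_apply_sum op_apply_smult op_apply_def[of d P])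
qed

lemma dpoly_eval_op_dpoly: "dpoly_eval d (op_dpoly Q j) x = op_apply d Q (x j)"
proof -
  have "dconst (Polynomial.coeff Q k) * dvar j k
      = Poly_Mapping.single (Poly_Mapping.single (j, k) 1) (Polynomial.coeff Q k)" for k
    by (simp add: dconst_def dvar_def mult_single)
  then show ?thesis
    by (simp add: op_dpoly_def op_apply_def dpoly_eval_sum dpoly_eval_single monomial_value_single)
qed

lemma universal_extension_base:
  assumes "universal_diff_extension d K"
  shows "field_closed K" "d ` K \<subseteq> K" "derivation_on UNIV d"
proof -
  have "field_closed (UNIV :: 'a set)" by (simp add: field_closed_def ring_closed_def)
  then show "field_closed K" "d ` K \<subseteq> K" "derivation_on UNIV d"
    using assms subfield_universe_ring_iff[of UNIV K]
    by (auto simp: universal_diff_extension_def Let_def diff_subfield_def diff_field_def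
        derivation_def derivation_on_def universe_ring_UNIV)
qed

text \<open>
  The universe contains a nonzero solution of every linear equation of positive order over \<open>K\<close>.  The
  generic solution of \<open>c\<^sub>m y^(m) + \<dots> + c\<^sub>0 y = 0\<close> generates the field \<open>K(y\<^sub>0, \<dots>, y\<^bsub>m-1\<^esub>)\<close> of rational
  functions, with \<open>y\<^sub>k\<close> standing for the \<open>k\<close>-th derivative.  As a field, it is already present in the
  universe: the derivatives of a differential indeterminate are algebraically independent, so they
  can serve as the \<open>y\<^sub>k\<close>.  Only the derivation changes: the new one sends \<open>y\<^bsub>m-1\<^esub>\<close> to
  \<open>-(c\<^sub>0 y\<^sub>0 + \<dots> + c\<^bsub>m-1\<^esub> y\<^bsub>m-1\<^esub>) / c\<^sub>m\<close>.  Universality embeds this differential field over \<open>K\<close>, and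
  the image of \<open>y\<^sub>0\<close> is the required solution.
\<close>

lemma universal_solution:
  fixes d :: "'a::Fields.field \<Rightarrow> 'a"
  assumes univ: "universal_diff_extension d K" and u: "diff_indeterminates d K I u" "i \<in> I"
    and h: "h \<in> polys_over K" "Polynomial.degree h > 0"
  obtains v where "v \<noteq> 0" "op_apply d h v = 0"
proof -
  let ?E = "ring_of_type_algebra :: 'a ring"
  note K = universal_extension_base(1)[OF univ] and dK = universal_extension_base(2)[OF univ]
    and d = universal_extension_base(3)[OF univ]
  define m where "m = Polynomial.degree h"
  define c where "c = Polynomial.coeff h"
  define y where "y k = (d ^^ k) (u i)" for k
  have c: "c k \<in> K" for k using h(1) by (simp add: c_def polys_over_def)
  have cm: "c m \<noteq> 0" using h(2) by (auto simp: c_def m_def)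
  have tr: "transcendental_over (tower K y k) (y k)" for k
    unfolding y_def by (rule derivatives_transcendental[OF K u])
  let ?T = "tower K y m"
  note T = field_closed_tower[OF K, of y m]
  note RT = ring_closedD[OF field_closedD(1)[OF T]]
  have KT: "K \<subseteq> ?T" by (rule base_subset_tower[OF K])
  have yT: "k < m \<Longrightarrow> y k \<in> ?T" for k by (rule generator_in_tower[OF K])
  define s where "s k = (if Suc k < m then y (Suc k) else - (\<Sum>l<m. c l * y l) / c m)" for k
  have "d ` K \<subseteq> ?T" using dK KT by auto
  have "derivation_on K d" using d by (simp add: derivation_on_def)
  then obtain D where D: "derivation_on ?T D" "\<And>x. x \<in> K \<Longrightarrow> D x = d x" "\<And>k. k < m \<Longrightarrow> D (y k) = s k"
    using derivation_extends_to_tower[OF K _ tr, of d m s] by blast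
  have sT: "s k \<in> ?T" for k
  proof -
    have "- (\<Sum>l<m. c l * y l) / c m \<in> ?T"
      using yT c KT by (intro field_closedD(3)[OF T] RT(3,8,5)) auto
    then show ?thesis using yT[of "Suc k"] by (simp add: s_def)
  qed
  have DT: "D ` ?T \<subseteq> ?T"
  proof (rule derivation_preserves_tower[OF K D(1)])
    show "D ` K \<subseteq> ?T" using D(2) \<open>d ` K \<subseteq> ?T\<close> by auto
  qed (simp add: D(3) sT)
  let ?L = "universe_ring ?T"
  have dsub: "diff_subfield ?E d K" using univ by (simp add: universal_diff_extension_def Let_def)
  \<comment> \<open>Universality is used over \<open>K\<close> itself, with no further generators.\<close>
  have gen_K: "K = diff_field_generated ?E d (K \<union> {})"
    using dsub by (auto simp: diff_field_generated_def)
  have "diff_subfield ?L D ?T"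
    using subfield_universe_ring_iff[OF T, of ?T] T DT by (simp add: diff_subfield_def)
  moreover have "?T \<subseteq> Q" if "diff_subfield ?L D Q" "K \<union> y ` {..<m} \<subseteq> Q" for Q
  proof (rule tower_subset)
    show "field_closed Q" using that(1) subfield_universe_ring_iff[OF T, of Q]
      by (simp add: diff_subfield_def)
  qed (use that(2) in auto)
  ultimately have gen_L: "carrier ?L = diff_field_generated ?L D (id ` K \<union> y ` {..<m})"
    using KT yT by (auto simp: diff_field_generated_def)
  have "diff_field ?L D"
    using field_universe_ring[OF T] D(1) DT
    by (auto simp: diff_field_def derivation_def derivation_on_def)
  moreover have "diff_hom (?E\<lparr>carrier := K\<rparr>) d ?L D id"
    using KT D(2) by (auto simp: diff_hom_def intro!: ring_hom_memI)
  moreover have "separable_over ?L (id ` K)"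
    using separable_over_tower[OF K tr] by simp
  moreover have "y ` {..<m} \<subseteq> carrier ?L" using yT by auto
  ultimately obtain g where g: "diff_hom ?L D ?E d g" "\<forall>x \<in> K. g (id x) = x"
    using univ[unfolded universal_diff_extension_def Let_def, THEN conjunct2, THEN conjunct2,
        rule_format, of "{}" K ?L D id "y ` {..<m}"] gen_K gen_L by auto
  have g_add: "g (a + b) = g a + g b" and g_mult: "g (a * b) = g a * g b"
    and g_D: "g (D a) = d (g a)" if "a \<in> ?T" "b \<in> ?T" for a b
    using g(1) that by (auto simp: diff_hom_def ring_hom_def)
  have g_one: "g 1 = 1" using g(1) by (simp add: diff_hom_def ring_hom_def)
  have g_K: "g a = a" if "a \<in> K" for a using g(2) that by simp
  have g_zero: "g 0 = 0" using g_K ring_closedD(2)[OF field_closedD(1)[OF K]] by blast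
  have g_sum: "g (sum f {..<j}) = (\<Sum>k<j. g (f k))" if "\<And>k. k < j \<Longrightarrow> f k \<in> ?T" for f :: "nat \<Rightarrow> 'a" and j
    using that
  proof (induction j)
    case (Suc j)
    have "sum f {..<j} \<in> ?T" using Suc.prems by (intro RT(8)) simp
    then show ?case using Suc by (simp add: g_add)
  qed (simp add: g_zero)
  have m0: "0 < m" using h(2) by (simp add: m_def)
  let ?v = "g (y 0)"
  have "y 0 \<noteq> 0"
  proof
    assume "y 0 = 0"
    moreover have "[:0, 1:] \<in> polys_over K" by (rule polys_over_closed(2)[OF field_closedD(1)[OF K]])
    ultimately show False using tr[of 0] by (auto simp: transcendental_over_def)
  qed
  then have "g (y 0) * g (inverse (y 0)) = 1"
    using g_mult[of "y 0" "inverse (y 0)"] yT[OF m0] field_closedD(2)[OF T] g_one by simp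
  then have nz: "?v \<noteq> 0" by auto
  have iterates: "(d ^^ k) ?v = g (y k)" if "k < m" for k
    using that
  proof (induction k)
    case (Suc k)
    then have "(d ^^ Suc k) ?v = g (D (y k))" using g_D[of "y k" 0] yT RT(2) by simp
    then show ?case using D(3)[of k] Suc.prems by (simp add: s_def)
  qed simp
  define r where "r = (\<Sum>l<m. c l * y l)"
  have rT: "r \<in> ?T" unfolding r_def using c KT yT by (intro RT(8,5)) auto
  have "(d ^^ m) ?v = d ((d ^^ (m - 1)) ?v)" using m0 by (cases m) auto
  also have "\<dots> = g (D (y (m - 1)))" using iterates[of "m - 1"] g_D[of "y (m - 1)" 0] yT RT(2) m0 by simp
  also have "D (y (m - 1)) = - r / c m" using D(3)[of "m - 1"] m0 by (simp add: s_def r_def)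
  finally have top: "(d ^^ m) ?v = g (- r / c m)" .
  have cmT: "c m \<in> ?T" and qT: "- r / c m \<in> ?T"
    using c KT rT by (auto intro!: field_closedD(3)[OF T] RT(3))
  have "c m * (d ^^ m) ?v + g r = g (c m) * g (- r / c m) + g r" by (simp only: top g_K[OF c])
  also have "\<dots> = g (c m * (- r / c m) + r)"
    by (simp only: g_mult[OF cmT qT] g_add[OF RT(5)[OF cmT qT] rT])
  finally have "c m * (d ^^ m) ?v + g r = g (c m * (- r / c m) + r)" .
  then have "c m * (d ^^ m) ?v + g r = 0" using cm g_zero by simp
  moreover have "g r = (\<Sum>l<m. c l * (d ^^ l) ?v)"
  proof -
    have "g r = (\<Sum>l<m. g (c l * y l))" unfolding r_def using c KT yT by (intro g_sum RT(5)) auto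
    then show ?thesis using c KT yT by (auto simp: g_mult g_K iterates subset_eq)
  qed
  ultimately have "op_apply d h ?v = 0"
    unfolding op_apply_def m_def[symmetric] c_def[symmetric]
    by (simp add: lessThan_Suc_atMost[symmetric] add.commute)
  then show thesis using nz that by blast
qed

lemma del_mult_one: "d 0 = 0 \<Longrightarrow> d 1 = 0 \<Longrightarrow> (del_mult d ^^ k) [:1:] = Polynomial.monom 1 k"
proof (induction k)
  case (Suc k)
  have "map_poly d (Polynomial.monom 1 k) = 0"
    using Suc.prems by (intro poly_eqI) (simp add: coeff_map_poly)
  then show ?case using Suc by (simp add: del_mult_def monom_Suc)
qed (simp add: monom_0)

lemma op_mult_one: "d 0 = 0 \<Longrightarrow> d 1 = 0 \<Longrightarrow> op_mult d Q [:1:] = Q"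
  by (simp add: op_mult_def del_mult_one smult_monom poly_as_sum_of_monoms)

text \<open>
  A nonzero constant is invertible in the ring of operators, so \<open>1\<close> is a greatest common right divisor
  as soon as all common right divisors have order zero.  The zero operator also has degree zero, but
  it divides only itself, so it is ruled out by the nonzero element of \<open>A\<close>.
\<close>

lemma right_coprimeI:
  assumes K: "field_closed K" and d: "d 0 = 0" "d 1 = 0"
    and A: "A \<subseteq> carrier (diff_ops d K)" "\<exists>a \<in> A. a \<noteq> 0"
    and deg: "\<And>h. h \<in> carrier (diff_ops d K) \<Longrightarrow> \<forall>a \<in> A. right_divides (diff_ops d K) h a \<Longrightarrow>
       Polynomial.degree h = 0"
  shows "right_coprime d K A"
proof -
  note RK = ring_closedD[OF field_closedD(1)[OF K]]
  let ?R = "diff_ops d K"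
  have car: "P \<in> carrier ?R \<longleftrightarrow> P \<in> polys_over K" for P by (simp add: diff_ops_def polys_over_def)
  have mult: "P \<otimes>\<^bsub>?R\<^esub> Q = op_mult d P Q" for P Q by (simp add: diff_ops_def)
  have const: "[:b:] \<in> carrier ?R" if "b \<in> K" for b
    using that polys_over_closed(1)[OF field_closedD(1)[OF K]] by (simp add: car)
  have "is_right_gcd ?R A [:1:]"
    unfolding is_right_gcd_def
  proof (intro conjI ballI impI)
    show "[:1:] \<in> carrier ?R" by (rule const[OF RK(1)])
    show "right_divides ?R [:1:] a" if "a \<in> A" for a
      using that A(1) op_mult_one[OF d, of a] by (auto simp: right_divides_def mult intro!: bexI[of _ a])
    fix h assume h: "h \<in> carrier ?R" "\<forall>a \<in> A. right_divides ?R h a"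
    obtain b where b: "h = [:b:]" using deg[OF h] by (auto elim: degree_eq_zeroE)
    have "b \<noteq> 0"
    proof
      assume "b = 0"
      have "(del_mult d ^^ k) 0 = 0" for k by (induction k) (auto simp: del_mult_def)
      then have "op_mult d q h = 0" for q using b \<open>b = 0\<close> by (simp add: op_mult_def)
      then show False using h(2) A(2) by (auto simp: right_divides_def mult)
    qed
    moreover have "b \<in> K" using h(1) b by (auto simp: diff_ops_def dest: spec[of _ 0])
    ultimately show "right_divides ?R h [:1:]"
      using const[OF field_closedD(2)[OF K]]
      by (auto simp: right_divides_def mult b op_mult_def intro!: bexI[of _ "[:inverse b:]"])
  qed
  then show ?thesis using RK(1) unfolding right_coprime_def by (intro bexI[of _ 1]) simp_all
qed

theorem theorem7p2:
  fixes d :: "'e::Fields.field \<Rightarrow> 'e"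
    and K :: "'e set"
    and n :: nat
    and u :: "nat \<Rightarrow> 'e"
    and a :: "nat \<Rightarrow> 'e"
    and L :: "nat \<Rightarrow> nat \<Rightarrow> 'e poly"
    and P :: "nat \<Rightarrow> 'e dpoly"
  assumes "n \<ge> 2"
    and "universal_diff_extension d K"
    and "diff_indeterminates d K {1..n-1} u"
    and "\<And>i. i \<in> {1..n} \<Longrightarrow> a i \<in> K"
    and "\<And>i j. i \<in> {1..n} \<Longrightarrow> j \<in> {1..n-1} \<Longrightarrow> L i j \<in> carrier (diff_ops d K)"
    and "\<And>j. j \<in> {1..n-1} \<Longrightarrow> \<exists>i \<in> {1..n}. L i j \<noteq> 0"
    and "\<And>i. i \<in> {1..n} \<Longrightarrow> P i = dconst (a i) - (\<Sum>j \<in> {1..n-1}. op_dpoly (L i j) j)"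
    and "proper_system d K n u P"
  shows "\<forall>j \<in> {1..n-1}. right_coprime d K ((\<lambda>i. L i j) ` {1..n})"
proof
  fix j assume j: "j \<in> {1..n-1}"
  note K = universal_extension_base(1)[OF assms(2)] and d = universal_extension_base(3)[OF assms(2)]
  have U: "ring_closed (UNIV :: 'e set)" by (simp add: ring_closed_def)
  show "right_coprime d K ((\<lambda>i. L i j) ` {1..n})"
  proof (rule right_coprimeI[OF K derivation_on_simps(1,2)[OF U d]])
    show "(\<lambda>i. L i j) ` {1..n} \<subseteq> carrier (diff_ops d K)" using assms(5) j by blast
    show "\<exists>l \<in> (\<lambda>i. L i j) ` {1..n}. l \<noteq> 0" using assms(6)[OF j] by blast
    fix h assume h: "h \<in> carrier (diff_ops d K)"
      and div: "\<forall>l \<in> (\<lambda>i. L i j) ` {1..n}. right_divides (diff_ops d K) h l"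
    show "Polynomial.degree h = 0"
    proof (rule ccontr)
      assume "Polynomial.degree h \<noteq> 0"
      moreover have "h \<in> polys_over K" using h by (simp add: diff_ops_def polys_over_def)
      ultimately obtain v where v: "v \<noteq> 0" "op_apply d h v = 0"
        using universal_solution[OF assms(2,3) j] by blast
      have killed: "op_apply d (L i j) v = 0" if i: "i \<in> {1..n}" for i
      proof -
        obtain q where "L i j = op_mult d q h"
          using bspec[OF div imageI[OF i]] by (auto simp: right_divides_def diff_ops_def)
        then show ?thesis using v(2) by (simp add: op_apply_op_mult[OF d] op_apply_argument_zero[OF d])
      qed
      obtain \<Gamma> \<tau> where \<tau>: "\<tau> \<in> {1..n-1} \<rightarrow>\<^sub>E UNIV" "\<forall>i \<in> {1..n}. \<Gamma> i = dpoly_eval d (P i) \<tau>"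
        and unique: "\<And>\<sigma>. \<sigma> \<in> {1..n-1} \<rightarrow>\<^sub>E UNIV \<Longrightarrow> \<forall>i \<in> {1..n}. \<Gamma> i = dpoly_eval d (P i) \<sigma> \<Longrightarrow> \<sigma> = \<tau>"
        using assms(8) unfolding proper_system_def Ex1_def by blast
      \<comment> \<open>Adding a solution of \<open>h\<close> to the \<open>j\<close>-th parameter does not move the point.\<close>
      define \<sigma> where "\<sigma> = \<tau>(j := \<tau> j + v)"
      have P_value: "dpoly_eval d (P i) x = a i - (\<Sum>l \<in> {1..n-1}. op_apply d (L i l) (x l))"
        if "i \<in> {1..n}" for i x
        by (simp add: assms(7)[OF that] dpoly_eval_diff dpoly_eval_sum dpoly_eval_op_dpoly dconst_def
            dpoly_eval_single monomial_value_zero)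
      have "op_apply d (L i l) (\<sigma> l) = op_apply d (L i l) (\<tau> l)" if "i \<in> {1..n}" for i l
        using killed[OF that] by (simp add: \<sigma>_def op_apply_argument_add[OF d])
      then have "\<forall>i \<in> {1..n}. \<Gamma> i = dpoly_eval d (P i) \<sigma>" using \<tau>(2) by (simp add: P_value)
      moreover have "\<sigma> \<in> {1..n-1} \<rightarrow>\<^sub>E UNIV" using \<tau>(1) j by (auto simp: \<sigma>_def PiE_def extensional_def)
      ultimately have "\<sigma> = \<tau>" by (rule unique[rotated])
      then show False using v(1) by (metis \<sigma>_def add_cancel_left_right fun_upd_same)
    qed
  qed
qed

end
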